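(* Let $G$ be a finite group. (i) If $G\in\Psi$, then $\dim(\mathcal P_G)=|G|-|\mathcal U(G)|+1$. (ii) If $G\notin\Psi$, then $\dim(\mathcal P_G)=|G|-|\mathcal U(G)|+|W(G)|$.
   Context: $\mathcal P_G$ is the power graph of $G$ (vertex set $G$, distinct elements adjacent iff one is a power of the other), with graph distance $d_{\mathcal P_G}$. A resolving set of a connected graph $\Gamma$ is an ordered vertex set $W=(w_1,\dots,w_k)$ such that the vectors $(d(v,w_1),\dots,d(v,w_k))$ are distinct for distinct vertices $v$; $\dim(\Gamma)$ is the minimum size of a resolving set. $N(x)$, $N[x]$ are the open/closed neighbourhoods of $x$ in $\mathcal P_G$; $x\equiv y$ iff $N(x)=N(y)$ or $N[x]=N[y]$ (an equivalence relation), $\overline{x}$ is the class of $x$ and $\mathcal U(G)$ the set of classes. $R\{x,y\}=\{z\in G: d_{\mathcal P_G}(x,z)\ne d_{\mathcal P_G}(y,z)\}$. A resolving involution is an element $w$ of order $2$ for which there exist $x,y\in G\setminus\overline{w}$ with $R\{x,y\}=\{x,y,w\}$; $W(G)$ is the set of resolving involutions. $\Psi$ is the class of finite noncyclic groups $G$ for which there exists an odd prime $p$ such that: (C1) the prime divisors of $|G|$ are exactly $2$ and $p$; (C2) $G$ has a unique subgroup of order $p$; (C3) $G$ has no element of order $4$; (C4) every involution of $G$ is contained in a cyclic subgroup of order $2p$. *)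

theory Defs
  imports
    "HOL-Algebra.Multiplicative_Group"
    "HOL-Algebra.Elementary_Groups"
    "Graph_Theory.Graph_Theory"
    "HOL-Computational_Algebra.Primes"
begin

text \<open>Undirected graphs are symmetric digraphs, as in the library locale \<^locale>\<open>graph\<close>.\<close>

definition power_graph :: "('a, 'b) monoid_scheme \<Rightarrow> ('a, 'a \<times> 'a) pre_digraph" where
  "power_graph G =
     \<lparr> verts = carrier G,
       arcs = {(x, y). x \<in> carrier G \<and> y \<in> carrier G \<and> x \<noteq> y \<and>
                 ((\<exists>n::nat. y = x [^]\<^bsub>G\<^esub> n) \<or> (\<exists>n::nat. x = y [^]\<^bsub>G\<^esub> n))},
       tail = fst, head = snd \<rparr>"

text \<open>The infimum of walk lengths (shortest path cost for unit weights); it is \<open>\<infinity>\<close> for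
  vertices in different components.\<close>

definition graph_dist :: "('v, 'e) pre_digraph \<Rightarrow> 'v \<Rightarrow> 'v \<Rightarrow> ereal" where
  "graph_dist \<Gamma> u v = wf_digraph.\<mu> \<Gamma> (\<lambda>_. 1) u v"

definition resolving_set :: "('v, 'e) pre_digraph \<Rightarrow> 'v list \<Rightarrow> bool" where
  "resolving_set \<Gamma> ws \<longleftrightarrow> distinct ws \<and> set ws \<subseteq> verts \<Gamma> \<and>
     inj_on (\<lambda>v. map (graph_dist \<Gamma> v) ws) (verts \<Gamma>)"

definition metric_dim :: "('v, 'e) pre_digraph \<Rightarrow> nat" where
  "metric_dim \<Gamma> = (LEAST k. \<exists>ws. resolving_set \<Gamma> ws \<and> length ws = k)"

definition open_nbhd :: "('v, 'e) pre_digraph \<Rightarrow> 'v \<Rightarrow> 'v set" where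
  "open_nbhd \<Gamma> x = {y. x \<rightarrow>\<^bsub>\<Gamma>\<^esub> y}"

definition closed_nbhd :: "('v, 'e) pre_digraph \<Rightarrow> 'v \<Rightarrow> 'v set" where
  "closed_nbhd \<Gamma> x = insert x (open_nbhd \<Gamma> x)"

definition twin_rel :: "('a, 'b) monoid_scheme \<Rightarrow> 'a rel" where
  "twin_rel G = {(x, y). x \<in> carrier G \<and> y \<in> carrier G \<and>
     (open_nbhd (power_graph G) x = open_nbhd (power_graph G) y \<or>
      closed_nbhd (power_graph G) x = closed_nbhd (power_graph G) y)}"

definition twin_class :: "('a, 'b) monoid_scheme \<Rightarrow> 'a \<Rightarrow> 'a set" where
  "twin_class G x = twin_rel G `` {x}"

definition twin_classes :: "('a, 'b) monoid_scheme \<Rightarrow> 'a set set" where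
  "twin_classes G = carrier G // twin_rel G"

definition resolvers :: "('a, 'b) monoid_scheme \<Rightarrow> 'a \<Rightarrow> 'a \<Rightarrow> 'a set" where
  "resolvers G x y =
     {z \<in> carrier G. graph_dist (power_graph G) x z \<noteq> graph_dist (power_graph G) y z}"

definition resolving_involutions :: "('a, 'b) monoid_scheme \<Rightarrow> 'a set" where
  "resolving_involutions G =
     {w \<in> carrier G. group.ord G w = 2 \<and>
        (\<exists>x \<in> carrier G - twin_class G w. \<exists>y \<in> carrier G - twin_class G w.
           resolvers G x y = {x, y, w})}"

definition Psi :: "('a, 'b) monoid_scheme set" where
  "Psi = {G. group G \<and> finite (carrier G) \<and> \<not> cyclic_group G \<and>
     (\<exists>p::nat. prime p \<and> odd p \<and>
        prime_factors (order G) = {2, p} \<and>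
        (\<exists>!H. subgroup H G \<and> card H = p) \<and>
        (\<forall>x \<in> carrier G. group.ord G x \<noteq> 4) \<and>
        (\<forall>w \<in> carrier G. group.ord G w = 2 \<longrightarrow>
           (\<exists>H. subgroup H G \<and> cyclic_group (G\<lparr>carrier := H\<rparr>) \<and> card H = 2 * p \<and> w \<in> H)))}"

lemma power_graph_simps [simp]:
  "verts (power_graph G) = carrier G"
  "tail (power_graph G) = fst"
  "head (power_graph G) = snd"
  by (simp_all add: power_graph_def)

lemma dominates_power_graph_iff:
  "x \<rightarrow>\<^bsub>power_graph G\<^esub> y \<longleftrightarrow> x \<in> carrier G \<and> y \<in> carrier G \<and> x \<noteq> y \<and>
     ((\<exists>n::nat. y = x [^]\<^bsub>G\<^esub> n) \<or> (\<exists>n::nat. x = y [^]\<^bsub>G\<^esub> n))"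
  by (auto simp: power_graph_def arcs_ends_conv)

lemma graph_power_graph:
  assumes "finite (carrier G)"
  shows "graph (power_graph G)"
proof -
  have "arcs (power_graph G) \<subseteq> carrier G \<times> carrier G"
    by (auto simp: power_graph_def)
  then have "finite (arcs (power_graph G))"
    using assms finite_subset by blast
  moreover have "sym (arcs_ends (power_graph G))"
    by (auto simp: sym_def dominates_power_graph_iff)
  ultimately show ?thesis
    using assms by unfold_locales (auto simp: symmetric_def power_graph_def arc_to_ends_def)
qed

lemma (in group) connected_power_graph:
  assumes "finite (carrier G)"
  shows "connected (power_graph G)"
proof -
  interpret P: graph "power_graph G"
    using assms by (rule graph_power_graph)
  have one: "x \<rightarrow>\<^sup>*\<^bsub>power_graph G\<^esub> \<one> \<and> \<one> \<rightarrow>\<^sup>*\<^bsub>power_graph G\<^esub> x" if x: "x \<in> carrier G" for x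
  proof (cases "x = \<one>")
    case False
    have "\<exists>n::nat. \<one> = x [^] n"
      by (metis nat_pow_0)
    then have "x \<rightarrow>\<^bsub>power_graph G\<^esub> \<one>" "\<one> \<rightarrow>\<^bsub>power_graph G\<^esub> x"
      using x False by (auto simp: dominates_power_graph_iff)
    then show ?thesis
      by (simp add: P.reachable_adjI)
  qed (simp add: P.reachable_refl)
  have "strongly_connected (power_graph G)"
    by (rule strongly_connectedI) (auto dest: one intro: P.reachable_trans)
  then show ?thesis
    by (auto simp: connected_def strongly_connected_def intro: P.reachable_mk_symmetricI)
qed

lemma equiv_twin_rel: "equiv (carrier G) (twin_rel G)"
proof (rule equivI)
  show "trans (twin_rel G)"
  proof (rule transI)
    fix x y z assume xy: "(x, y) \<in> twin_rel G" and yz: "(y, z) \<in> twin_rel G"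
    let ?N = "open_nbhd (power_graph G)"
    have irr: "a \<notin> ?N a" for a
      by (simp add: open_nbhd_def dominates_power_graph_iff)
    have sym: "a \<in> ?N b \<longleftrightarrow> b \<in> ?N a" for a b
      by (auto simp: open_nbhd_def dominates_power_graph_iff)
    have "?N x = ?N z \<or> insert x (?N x) = insert z (?N z)"
    proof (rule ccontr)
      assume "\<not> ?thesis"
      then show False
        using xy yz irr sym unfolding twin_rel_def closed_nbhd_def
        by (smt (verit) case_prodD insert_iff mem_Collect_eq)
    qed
    then show "(x, z) \<in> twin_rel G"
      using xy yz by (auto simp: twin_rel_def closed_nbhd_def)
  qed
qed (auto simp: twin_rel_def sym_def refl_on_def)

end

theory Submission
  imports Defs "HOL-Algebra.Sylow" "HOL-Number_Theory.Cong"
begin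

text \<open>
  The power graph has diameter at most 2, and two twins are resolved only by themselves. Hence the
  complement of a resolving set contains at most one element of each twin class, and the question is
  how many classes must lie entirely inside the resolving set. A full transversal \<open>T\<close> of the
  classes fails to have a resolving complement iff \<open>R{x, y} \<subseteq> T\<close> for some
  non-twins \<open>x, y\<close>. Since \<open>z\<close> and \<open>z\<^sup>-\<^sup>1\<close> are twins, the
  elements of \<open>R{x, y}\<close> other than \<open>x, y\<close> are then involutions with a singleton
  twin class; such pairs are called critical below.

  A critical pair is adjacent, say \<open>y\<close> is a power of \<open>x\<close>. If \<open>y \<noteq> 1\<close>,
  then \<open>y\<close> has odd prime order and \<open>R{x, y} = {x, y, w}\<close>, where \<open>w\<close> is the
  involution in \<open>\<langle>x\<rangle>\<close>. If \<open>y = 1\<close>, then \<open>x\<close> has odd prime order, every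
  element that is not an involution is comparable with \<open>x\<close>, and \<open>R{x, 1}\<close> contains all
  involutions; then \<open>G\<close> is cyclic or belongs to \<open>\<Psi>\<close>. In \<open>\<Psi>\<close> a single
  involution meets every \<open>R{x, y}\<close>. Outside \<open>\<Psi>\<close> the triples of classes of
  \<open>x, y, w\<close> belonging to different \<open>w\<close> are disjoint, so exactly one class has to be
  added for each resolving involution.
\<close>

section \<open>Distances 0, 1 and 2 in unit-weighted digraphs\<close>

lemma (in wf_digraph) mu_unit_eq_0: "u \<in> verts G \<Longrightarrow> \<mu> (\<lambda>_. 1) u u = 0"
proof -
  assume u: "u \<in> verts G"
  have "\<mu> (\<lambda>_. 1) u u \<le> 0"
    using min_cost_le_walk_cost[of u "[]" u "\<lambda>_. 1"] u
    by (simp add: awalk_Nil_iff zero_ereal_def)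
  moreover have "0 \<le> \<mu> (\<lambda>_. 1) u u"
    unfolding \<mu>_def by (rule INF_greatest) (auto intro: pos_cost_pos_awalk_cost)
  ultimately show ?thesis by simp
qed

lemma (in wf_digraph) mu_unit_ge_1:
  assumes "u \<noteq> v"
  shows "1 \<le> \<mu> (\<lambda>_. 1) u v"
  unfolding \<mu>_def
proof (rule INF_greatest)
  fix p assume "p \<in> {p. awalk u p v}"
  then have "p \<noteq> []" using assms by (auto simp: awalk_Nil_iff)
  then have "1 \<le> real (length p)" by (cases p) auto
  then show "1 \<le> ereal (awalk_cost (\<lambda>_. 1) p)"
    by (simp add: awalk_cost_def sum_list_triv)
qed

lemma (in wf_digraph) mu_unit_eq_1:
  assumes "u \<noteq> v" "u \<rightarrow> v"
  shows "\<mu> (\<lambda>_. 1) u v = 1"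
proof (rule antisym)
  obtain e where e: "e \<in> arcs G" "tail G e = u" "head G e = v"
    using assms by (auto simp: arcs_ends_def arc_to_ends_def)
  then have "awalk u [e] v" by (auto simp: awalk_simps)
  from min_cost_le_walk_cost[OF this, of "\<lambda>_. 1"]
  show "\<mu> (\<lambda>_. 1) u v \<le> 1" by (simp add: one_ereal_def)
qed (use assms mu_unit_ge_1 in auto)

text \<open>The lower bound holds because a walk of length below 2 is empty or a single arc from u
  to v, and both are excluded.\<close>

lemma (in wf_digraph) mu_unit_eq_2:
  assumes "u \<noteq> v" "\<not> u \<rightarrow> v" "u \<rightarrow> w" "w \<rightarrow> v"
  shows "\<mu> (\<lambda>_. 1) u v = 2"
proof (rule antisym)
  obtain e where e: "e \<in> arcs G" "tail G e = u" "head G e = w"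
    using assms by (auto simp: arcs_ends_def arc_to_ends_def)
  obtain f where f: "f \<in> arcs G" "tail G f = w" "head G f = v"
    using assms by (auto simp: arcs_ends_def arc_to_ends_def)
  have "awalk u [e, f] v" using e f by (auto simp: awalk_simps)
  from min_cost_le_walk_cost[OF this, of "\<lambda>_. 1"]
  show "\<mu> (\<lambda>_. 1) u v \<le> 2" by simp
  show "2 \<le> \<mu> (\<lambda>_. 1) u v"
    unfolding \<mu>_def
  proof (rule INF_greatest)
    fix p assume "p \<in> {p. awalk u p v}"
    then have p: "awalk u p v" by simp
    have "2 \<le> length p"
    proof (rule ccontr)
      assume "\<not> 2 \<le> length p"
      then have "p = [] \<or> (\<exists>e. p = [e])" by (cases p) (auto simp: Suc_le_eq)
      then show False
        using p assms by (auto simp: awalk_simps dest: in_arcs_imp_in_arcs_ends)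
    qed
    then have "2 \<le> real (length p)" by simp
    then show "2 \<le> ereal (awalk_cost (\<lambda>_. 1) p)"
      by (simp add: awalk_cost_def sum_list_triv)
  qed
qed

section \<open>Powers in finite groups\<close>

locale finite_group = group G for G (structure) +
  assumes finite_carrier: "finite (carrier G)"
begin

text \<open>This is membership of y in the cyclic subgroup generated by x; natural exponents suffice
  because G is finite. Adjacency in the power graph is comparability of distinct elements under this
  preorder.\<close>

definition spans :: "'a \<Rightarrow> 'a \<Rightarrow> bool" (infix \<open>\<unrhd>\<close> 50) where
  "x \<unrhd> y \<longleftrightarrow> (\<exists>n::nat. y = x [^] n)"

lemma spans_refl: "x \<in> carrier G \<Longrightarrow> x \<unrhd> x"
  unfolding spans_def by (metis nat_pow_eone)

lemma spans_one: "x \<unrhd> \<one>"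
  unfolding spans_def by (metis nat_pow_0)

lemma spans_pow: "x \<unrhd> x [^] (n::nat)"
  unfolding spans_def by blast

lemma spans_trans: "x \<in> carrier G \<Longrightarrow> x \<unrhd> y \<Longrightarrow> y \<unrhd> z \<Longrightarrow> x \<unrhd> z"
  unfolding spans_def by (metis nat_pow_pow)

lemma ord_pos: "x \<in> carrier G \<Longrightarrow> 0 < ord x"
  using ord_ge_1[OF finite_carrier] by (metis less_le_trans zero_less_one)

lemma spans_inv: "x \<in> carrier G \<Longrightarrow> x \<unrhd> inv x"
proof -
  assume x: "x \<in> carrier G"
  have "x [^] (ord x - 1) \<otimes> x = \<one>"
    using x ord_pos[OF x] nat_pow_Suc[of x "ord x - 1"] by simp
  then have "inv x = x [^] (ord x - 1)"
    using x by (simp add: inv_equality)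
  then show ?thesis by (simp add: spans_pow)
qed

lemma ord_dvd_if_spans: "x \<in> carrier G \<Longrightarrow> x \<unrhd> y \<Longrightarrow> ord y dvd ord x"
  unfolding spans_def
  by (metis nat_pow_closed nat_pow_pow pow_eq_id dvd_triv_right)

lemma pow_mod_ord: "x \<in> carrier G \<Longrightarrow> x [^] (n mod ord x) = x [^] n"
proof -
  assume x: "x \<in> carrier G"
  have "x [^] n = x [^] (ord x * (n div ord x)) \<otimes> x [^] (n mod ord x)"
    using x by (simp add: nat_pow_mult)
  also have "x [^] (ord x * (n div ord x)) = \<one>"
    using x by (simp add: pow_eq_id)
  finally show ?thesis using x by simp
qed

lemma spans_commute:
  assumes "x \<in> carrier G" "x \<unrhd> u" "x \<unrhd> v"
  shows "u \<otimes> v = v \<otimes> u"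
  using assms unfolding spans_def by (metis nat_pow_mult add.commute)

text \<open>A cyclic group has only one subgroup of each order. With u = x^a and v = x^b, the order
  condition forces gcd b (\<open>ord x\<close>) to divide a, and Bezout writes this gcd as a
  multiple of b modulo \<open>ord x\<close>.\<close>

lemma spans_if_ord_dvd:
  assumes x: "x \<in> carrier G" and u: "x \<unrhd> u" and v: "x \<unrhd> v" and dvd: "ord u dvd ord v"
  shows "v \<unrhd> u"
proof -
  obtain a b :: nat where a: "u = x [^] a" and b: "v = x [^] b"
    using u v unfolding spans_def by blast
  let ?N = "ord x" and ?g = "gcd b (ord x)"
  have N: "?N > 0" using x by (rule ord_pos)
  have v_pow: "v [^] (?N div ?g) = \<one>"
  proof -
    have "?N dvd b * (?N div ?g)"
      by (metis dvd_div_mult dvd_triv_left gcd_dvd1 gcd_dvd2 mult.commute div_mult_swap)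
    then show ?thesis using x b by (simp add: nat_pow_pow pow_eq_id)
  qed
  have "ord u dvd ?N div ?g"
    using v_pow dvd x b by (metis dvd_trans nat_pow_closed pow_eq_id)
  then have "u [^] (?N div ?g) = \<one>"
    using x a by (simp add: pow_eq_id)
  then have "?N dvd a * (?N div ?g)"
    using x a by (simp add: nat_pow_pow pow_eq_id)
  then have "?g * (?N div ?g) dvd a * (?N div ?g)" by simp
  moreover have "?N div ?g \<noteq> 0"
    using N by (simp add: dvd_div_eq_0_iff)
  ultimately have "?g dvd a"
    by (metis dvd_times_right_cancel_iff)
  then obtain t where t: "a = ?g * t" ..
  \<comment> \<open>\<open>bezout_nat\<close> requires b to be nonzero. For b = 0 the gcd is
    \<open>ord x\<close>, which vanishes modulo \<open>ord x\<close>.\<close>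
  obtain s :: nat where s: "[b * s = ?g] (mod ?N)"
  proof (cases "b = 0")
    case True
    then have "[b * 0 = ?g] (mod ?N)" by (simp add: cong_def)
    then show ?thesis using that by blast
  next
    case False
    then obtain p q where "b * p = ?N * q + ?g"
      using bezout_nat by blast
    then have "[b * p = ?g] (mod ?N)" by (simp add: cong_def)
    then show ?thesis using that by blast
  qed
  have "[b * (s * t) = a] (mod ?N)"
    using cong_scalar_right[OF s, of t] by (simp add: t mult.assoc)
  then have "x [^] (b * (s * t)) = x [^] a"
    using x by (metis cong_def pow_mod_ord)
  then have "u = v [^] (s * t)"
    using x a b by (simp add: nat_pow_pow)
  then show ?thesis by (simp add: spans_pow)
qed

lemma spans_sym_if_ord_eq:
  "x \<in> carrier G \<Longrightarrow> x \<unrhd> y \<Longrightarrow> ord x = ord y \<Longrightarrow> y \<unrhd> x"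
  using spans_if_ord_dvd[of x x y] by (simp add: spans_refl)

lemma spanned_by_involution:
  assumes "w \<in> carrier G" "ord w = 2" "w \<unrhd> y" shows "y = \<one> \<or> y = w"
proof -
  obtain n :: nat where n: "y = w [^] n" using assms unfolding spans_def by blast
  have "w [^] n = w [^] (n mod 2)"
    using assms by (metis pow_mod_ord)
  moreover have "n mod 2 = 0 \<or> n mod 2 = 1" by auto
  ultimately show ?thesis using n assms by auto
qed

lemma unique_spanned_involution:
  assumes "x \<in> carrier G" "x \<unrhd> u" "x \<unrhd> v" "ord u = 2" "ord v = 2"
  shows "u = v"
proof -
  have c: "u \<in> carrier G" "v \<in> carrier G" using assms by (auto simp: spans_def)
  have "u \<unrhd> v" using assms spans_if_ord_dvd by simp
  then show ?thesis
    using spanned_by_involution[of u v] c assms by auto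
qed

lemma exists_spanned_of_ord:
  assumes "x \<in> carrier G" "d dvd ord x"
  obtains y where "y \<in> carrier G" "x \<unrhd> y" "ord y = d"
proof
  let ?y = "x [^] (ord x div d)"
  show "?y \<in> carrier G" "x \<unrhd> ?y" using assms by (auto simp: spans_pow)
  have "ord x div d \<noteq> 0"
    using assms ord_pos[of x] by (simp add: dvd_div_eq_0_iff)
  then show "ord ?y = d"
    using assms ord_pos[of x] ord_pow[of x "ord x div d"]
    by (metis div_dvd_div dvd_div_mult_self dvd_triv_left nonzero_mult_div_cancel_left)
qed

lemma inv_eq_self_iff:
  assumes "x \<in> carrier G" shows "inv x = x \<longleftrightarrow> ord x = 1 \<or> ord x = 2"
proof -
  have "inv x = x \<longleftrightarrow> x [^] (2::nat) = \<one>"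
    using assms by (metis inv_equality nat_pow_closed numeral_2_eq_2 nat_pow_Suc nat_pow_eone One_nat_def r_inv)
  also have "\<dots> \<longleftrightarrow> ord x dvd 2" using assms by (rule pow_eq_id)
  also have "\<dots> \<longleftrightarrow> ord x = 1 \<or> ord x = 2"
    by (metis two_is_prime_nat prime_nat_iff dvd_refl one_dvd)
  finally show ?thesis .
qed

text \<open>The power of x w with odd exponent \<open>ord x\<close> is w, and the next power is
  x.\<close>

lemma mult_involution_spans:
  assumes x: "x \<in> carrier G" "odd (ord x)" and w: "w \<in> carrier G" "ord w = 2"
    and comm: "x \<otimes> w = w \<otimes> x"
  shows "x \<otimes> w \<unrhd> x" "x \<otimes> w \<unrhd> w" "ord (x \<otimes> w) = 2 * ord x"
proof -
  let ?z = "x \<otimes> w"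
  have z: "?z \<in> carrier G" using x w by simp
  have pow: "?z [^] n = x [^] n \<otimes> w [^] n" for n :: nat
    using pow_mult_distrib[OF comm] x w by simp
  have "w [^] ord x = w" 
    using x w by (metis (no_types, lifting) nat_pow_eone odd_iff_mod_2_eq_one pow_mod_ord)
  then have "?z [^] ord x = w" using pow x w by simp
  then show zw: "?z \<unrhd> w" by (metis spans_pow)
  have "w [^] Suc (ord x) = \<one>"
    using x w by (metis even_Suc pow_eq_id)
  then have "?z [^] Suc (ord x) = x"
    using pow[of "Suc (ord x)"] x w by simp
  then show zx: "?z \<unrhd> x" by (metis spans_pow)
  have "2 dvd ord ?z" "ord x dvd ord ?z"
    using ord_dvd_if_spans z zw zx w by metis+
  then have "2 * ord x dvd ord ?z"
    using x by (simp add: divides_mult)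
  moreover have "ord ?z dvd ord x * ord w"
    using ord_mul_divides[OF comm] x w by blast
  ultimately show "ord ?z = 2 * ord x"
    using w by (simp add: dvd_antisym mult.commute)
qed

section \<open>Lagrange's and Cauchy's theorems for element orders\<close>

lemma ord_dvd_card_subgroup:
  assumes H: "subgroup H G" and x: "x \<in> H"
  shows "ord x dvd card H"
proof -
  interpret H: group "G\<lparr>carrier := H\<rparr>"
    using H by (rule subgroup.subgroup_is_group) (rule is_group)
  have "x [^] card H = \<one>"
    using H.pow_order_eq_1[of x] x by (simp add: order_def flip: nat_pow_consistent)
  then show ?thesis
    using H x subgroup.mem_carrier pow_eq_id by metis
qed

text \<open>Sylow's theorem with exponent 1 gives a subgroup of order p, and each of its nontrivial
  elements has order p.\<close>

lemma cauchy:
  assumes "prime p" "p dvd order G"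
  obtains x where "x \<in> carrier G" "ord x = p"
proof -
  obtain m where "order G = p ^ 1 * m" using assms by auto
  then obtain H where H: "subgroup H G" "card H = p"
    using sylow_thm[OF assms(1) is_group _ finite_carrier, of 1 m] by auto
  obtain x where x: "x \<in> H" "x \<noteq> \<one>"
    using H assms(1) by (metis card_1_singleton_iff is_singletonI' is_singleton_altdef not_prime_1 subgroup.one_closed empty_iff)
  have xc: "x \<in> carrier G" using H x subgroup.mem_carrier by metis
  have "ord x dvd p" using ord_dvd_card_subgroup H x by metis
  then show thesis using that xc x assms(1) by (metis ord_eq_1 prime_nat_iff)
qed

section \<open>Twins and resolving sets\<close>

definition adj :: "'a \<Rightarrow> 'a \<Rightarrow> bool" (infix \<open>\<frown>\<close> 50) where
  "x \<frown> y \<longleftrightarrow> x \<in> carrier G \<and> y \<in> carrier G \<and> x \<noteq> y \<and> (x \<unrhd> y \<or> y \<unrhd> x)"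

abbreviation twin :: "'a \<Rightarrow> 'a \<Rightarrow> bool" (infix \<open>\<simeq>\<close> 50) where
  "x \<simeq> y \<equiv> (x, y) \<in> twin_rel G"

lemma dominates_iff_adj: "x \<rightarrow>\<^bsub>power_graph G\<^esub> y \<longleftrightarrow> x \<frown> y"
  by (simp add: dominates_power_graph_iff adj_def spans_def)

lemma adj_sym: "x \<frown> y \<longleftrightarrow> y \<frown> x"
  by (auto simp: adj_def)

lemma adj_one: "x \<in> carrier G \<Longrightarrow> x \<noteq> \<one> \<Longrightarrow> x \<frown> \<one>"
  by (simp add: adj_def spans_one)

text \<open>Equal open neighbourhoods describe nonadjacent twins, equal closed neighbourhoods
  adjacent ones. In both cases the condition is that every third vertex sees both of x, y or
  neither.\<close>

lemma twin_iff:
  "x \<simeq> y \<longleftrightarrow> x \<in> carrier G \<and> y \<in> carrier G \<and>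
     (x = y \<or> (\<forall>z. z \<noteq> x \<longrightarrow> z \<noteq> y \<longrightarrow> x \<frown> z \<longleftrightarrow> y \<frown> z))"
proof -
  have "{z. x \<frown> z} = {z. y \<frown> z} \<or> insert x {z. x \<frown> z} = insert y {z. y \<frown> z} \<longleftrightarrow>
     (x = y \<or> (\<forall>z. z \<noteq> x \<longrightarrow> z \<noteq> y \<longrightarrow> x \<frown> z \<longleftrightarrow> y \<frown> z))" (is "?L \<longleftrightarrow> ?R")
  proof
    show "?L \<Longrightarrow> ?R" by blast
    show ?L if ?R
    proof (cases "x = y \<or> \<not> x \<frown> y")
      case True
      then have "x \<frown> z \<longleftrightarrow> y \<frown> z" for z
        using \<open>?R\<close> adj_sym[of x y] by (cases "z = x \<or> z = y") (auto simp: adj_def)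
      then show ?thesis by blast
    next
      case False
      then have "z = x \<or> x \<frown> z \<longleftrightarrow> z = y \<or> y \<frown> z" for z
        using \<open>?R\<close> adj_sym[of x y] by (cases "z = x \<or> z = y") auto
      then show ?thesis by blast
    qed
  qed
  then show ?thesis
    by (simp add: twin_rel_def open_nbhd_def closed_nbhd_def dominates_iff_adj)
qed

lemma twin_adj_iff: "x \<simeq> y \<Longrightarrow> z \<noteq> x \<Longrightarrow> z \<noteq> y \<Longrightarrow> x \<frown> z \<longleftrightarrow> y \<frown> z"
  unfolding twin_iff by blast

lemma twin_refl: "x \<in> carrier G \<Longrightarrow> x \<simeq> x"
  by (simp add: twin_iff)

lemma twin_sym: "x \<simeq> y \<Longrightarrow> y \<simeq> x"
  by (auto simp: twin_iff)

lemma twin_trans: "x \<simeq> y \<Longrightarrow> y \<simeq> z \<Longrightarrow> x \<simeq> z"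
  using equiv_twin_rel[of G] by (meson equiv_def transE)

lemma twin_carrier: "x \<simeq> y \<Longrightarrow> x \<in> carrier G \<and> y \<in> carrier G"
  by (simp add: twin_iff)

lemma twin_if_spans_both:
  assumes "x \<in> carrier G" "x \<unrhd> y" "y \<unrhd> x" shows "x \<simeq> y"
proof -
  have y: "y \<in> carrier G" using assms by (auto simp: spans_def)
  show ?thesis
    using assms y unfolding twin_iff adj_def by (metis spans_trans)
qed

text \<open>The identity is adjacent to all other vertices, so it is the middle vertex of a path
  between any two nonadjacent ones.\<close>

lemma graph_dist_power_graph:
  assumes "x \<in> carrier G" "y \<in> carrier G"
  shows "graph_dist (power_graph G) x y = (if x = y then 0 else if x \<frown> y then 1 else 2)"
proof -
  interpret P: graph "power_graph G"
    using finite_carrier by (rule graph_power_graph)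
  have "P.\<mu> (\<lambda>_. 1) x y = 2" if "x \<noteq> y" "\<not> x \<frown> y"
  proof (rule P.mu_unit_eq_2)
    have "x \<noteq> \<one>" "y \<noteq> \<one>"
      using that assms adj_one adj_sym by metis+
    then show "x \<rightarrow>\<^bsub>power_graph G\<^esub> \<one>" "\<one> \<rightarrow>\<^bsub>power_graph G\<^esub> y"
      using assms adj_one adj_sym by (auto simp: dominates_iff_adj)
  qed (use that in \<open>auto simp: dominates_iff_adj\<close>)
  then show ?thesis
    using assms P.mu_unit_eq_0[of y] P.mu_unit_eq_1[of x y]
    by (auto simp: graph_dist_def dominates_iff_adj)
qed

lemma resolvers_iff:
  assumes "x \<in> carrier G" "y \<in> carrier G"
  shows "z \<in> resolvers G x y \<longleftrightarrow>
    z \<in> carrier G \<and> x \<noteq> y \<and> (z = x \<or> z = y \<or> (x \<frown> z \<longleftrightarrow> \<not> y \<frown> z))"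
  using assms
  by (auto simp: resolvers_def graph_dist_power_graph adj_def split: if_splits)

lemma resolvers_commute: "resolvers G x y = resolvers G y x"
  by (auto simp: resolvers_def)

lemma resolvers_twin: "x \<simeq> y \<Longrightarrow> resolvers G x y \<subseteq> {x, y}"
  by (metis insertCI resolvers_iff subsetI twin_adj_iff twin_carrier)

text \<open>Since x and y both differ from z and v, the twins z and v have the same adjacency to
  each of them.\<close>

lemma resolvers_closed_under_twin:
  assumes "x \<in> carrier G" "y \<in> carrier G" "z \<in> resolvers G x y" "z \<simeq> v" "z \<notin> {x, y}" "v \<notin> {x, y}"
  shows "v \<in> resolvers G x y"
proof (cases "v = z")
  case False
  have "z \<frown> x \<longleftrightarrow> v \<frown> x" "z \<frown> y \<longleftrightarrow> v \<frown> y"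
    using assms twin_adj_iff by auto
  then show ?thesis
    using assms twin_carrier[of z v] by (auto simp: resolvers_iff adj_sym)
qed (use assms in simp)

text \<open>A set version of \<open>resolving_set\<close>: the order of the list is irrelevant, and
  the distance vectors are distinct exactly when every resolver set is met.\<close>

definition resolves :: "'a set \<Rightarrow> bool" where
  "resolves S \<longleftrightarrow> S \<subseteq> carrier G \<and>
     (\<forall>x \<in> carrier G. \<forall>y \<in> carrier G. x \<noteq> y \<longrightarrow> resolvers G x y \<inter> S \<noteq> {})"

lemma resolving_set_iff: "resolving_set (power_graph G) ws \<longleftrightarrow> distinct ws \<and> resolves (set ws)"
proof -
  have "inj_on (\<lambda>v. map (graph_dist (power_graph G) v) ws) (carrier G) \<longleftrightarrow>
    (\<forall>x \<in> carrier G. \<forall>y \<in> carrier G. x \<noteq> y \<longrightarrow> resolvers G x y \<inter> set ws \<noteq> {})"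
    if "set ws \<subseteq> carrier G"
    using that unfolding inj_on_def resolvers_def by auto blast+
  then show ?thesis
    by (auto simp: resolving_set_def resolves_def)
qed

lemma metric_dim_eqI:
  assumes "resolves S" "card S = k" "\<And>S. resolves S \<Longrightarrow> k \<le> card S"
  shows "metric_dim (power_graph G) = k"
  unfolding metric_dim_def
proof (rule Least_equality)
  have "finite S" using assms(1) finite_carrier finite_subset by (auto simp: resolves_def)
  then obtain ws where "set ws = S" "distinct ws" using finite_distinct_list by blast
  then show "\<exists>ws. resolving_set (power_graph G) ws \<and> length ws = k"
    using assms by (auto simp: resolving_set_iff distinct_card intro!: exI[of _ ws])
next
  fix n assume "\<exists>ws. resolving_set (power_graph G) ws \<and> length ws = n"
  then show "k \<le> n"
    using assms(3) by (metis resolving_set_iff distinct_card)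
qed

section \<open>Twin classes and the two counting bounds\<close>

lemma twin_class_iff: "v \<in> twin_class G w \<longleftrightarrow> w \<simeq> v"
  by (simp add: twin_class_def)

lemma twin_class_in_classes: "x \<in> carrier G \<Longrightarrow> twin_class G x \<in> twin_classes G"
  by (simp add: twin_class_def twin_classes_def quotientI)

lemma twin_class_eq_iff:
  "x \<in> carrier G \<Longrightarrow> y \<in> carrier G \<Longrightarrow> twin_class G x = twin_class G y \<longleftrightarrow> x \<simeq> y"
  unfolding twin_class_def by (rule eq_equiv_class_iff[OF equiv_twin_rel])

lemma finite_twin_classes: "finite (twin_classes G)"
  unfolding twin_classes_def
  by (rule finite_quotient[OF finite_carrier]) (auto simp: twin_rel_def)

text \<open>Twins are resolved only by themselves, so each class has at most one element outside S,
  and the classes in M have none. Hence the complement of S injects into the classes not in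
  M.\<close>

lemma card_resolving_ge:
  assumes S: "resolves S" and M: "M \<subseteq> twin_classes G" "\<And>C. C \<in> M \<Longrightarrow> C \<subseteq> S"
  shows "order G - card (twin_classes G) + card M \<le> card S"
proof -
  let ?T = "carrier G - S"
  have SG: "S \<subseteq> carrier G" using S by (simp add: resolves_def)
  have inj: "inj_on (twin_class G) ?T"
  proof (rule inj_onI, rule ccontr)
    fix x y assume xy: "x \<in> ?T" "y \<in> ?T" "twin_class G x = twin_class G y" "x \<noteq> y"
    then have "resolvers G x y \<subseteq> {x, y}"
      using twin_class_eq_iff resolvers_twin by blast
    then show False using S xy unfolding resolves_def by blast
  qed
  have "twin_class G ` ?T \<inter> M = {}"
  proof -
    have "twin_class G t \<notin> M" if "t \<in> ?T" for t
      using that M(2)[of "twin_class G t"] twin_refl twin_class_iff by blast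
    then show ?thesis by blast
  qed
  moreover have "twin_class G ` ?T \<union> M \<subseteq> twin_classes G"
    using M(1) twin_class_in_classes by blast
  moreover have "finite M" using M(1) finite_twin_classes finite_subset by blast
  ultimately have "card ?T + card M \<le> card (twin_classes G)"
    using card_mono[OF finite_twin_classes, of "twin_class G ` ?T \<union> M"] finite_carrier
    by (simp add: card_Un_disjoint card_image[OF inj])
  moreover have "card ?T = order G - card S"
    using SG finite_carrier by (simp add: order_def card_Diff_subset finite_subset)
  moreover have "card S \<le> order G"
    using SG finite_carrier by (simp add: order_def card_mono)
  \<comment> \<open>This keeps the natural-number subtraction in the claim from truncating.\<close>
  moreover have "card (twin_classes G) \<le> order G"
  proof -
    have "twin_classes G = twin_class G ` carrier G"
      by (auto simp: twin_classes_def twin_class_def quotient_def)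
    then show ?thesis using finite_carrier by (simp add: order_def card_image_le)
  qed
  ultimately show ?thesis by linarith
qed

definition lone_involution :: "'a \<Rightarrow> bool" where
  "lone_involution w \<longleftrightarrow> w \<in> carrier G \<and> ord w = 2 \<and> twin_class G w = {w}"

text \<open>The obstructions to the complement of a transversal being resolving. The condition
  follows from R{x, y} lying in some transversal, but it does not mention the transversal, so it can
  be studied inside the group.\<close>

definition critical :: "'a \<Rightarrow> 'a \<Rightarrow> bool" where
  "critical x y \<longleftrightarrow> x \<in> carrier G \<and> y \<in> carrier G \<and> \<not> x \<simeq> y \<and>
     (\<forall>z \<in> resolvers G x y - {x, y}. lone_involution z)"

text \<open>For a transversal T of the classes, the witness is the complement of T - c. A pair that
  it fails to resolve has its resolver set inside T - c, hence is critical, hence has a resolver in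
  c, a contradiction.\<close>

lemma exists_resolving:
  assumes c: "\<And>w. w \<in> c \<Longrightarrow> lone_involution w"
    and crit: "\<And>x y. critical x y \<Longrightarrow> resolvers G x y \<inter> c \<noteq> {}"
  obtains S where "resolves S" "card S = order G - card (twin_classes G) + card c"
proof -
  define rep where "rep = (\<lambda>C :: 'a set. SOME x. x \<in> C)"
  define T where "T = rep ` twin_classes G"
  have rep: "rep C \<in> C" if "C \<in> twin_classes G" for C
  proof -
    have "C \<noteq> {}" using that in_quotient_imp_non_empty[OF equiv_twin_rel]
      by (auto simp: twin_classes_def)
    then show ?thesis unfolding rep_def by (simp add: some_in_eq)
  qed
  have cls: "C = twin_class G x" if "C \<in> twin_classes G" "x \<in> C" for C x
    using that equiv_twin_rel unfolding twin_classes_def twin_class_def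
    by (metis equiv_class_eq_iff quotientE Image_singleton_iff)
  have sub: "C \<subseteq> carrier G" if "C \<in> twin_classes G" for C
    using that in_quotient_imp_subset[OF equiv_twin_rel] by (auto simp: twin_classes_def)
  have "inj_on rep (twin_classes G)"
    using rep cls by (metis inj_onI)
  then have cardT: "card T = card (twin_classes G)"
    unfolding T_def by (rule card_image)
  have TG: "T \<subseteq> carrier G" using rep sub unfolding T_def by blast
  have T_eq: "x = y" if xy: "x \<in> T" "y \<in> T" "x \<simeq> y" for x y
  proof -
    obtain C D where CD: "C \<in> twin_classes G" "x = rep C" "D \<in> twin_classes G" "y = rep D"
      using xy unfolding T_def by blast
    then have "C = twin_class G x" "D = twin_class G y" using cls rep by metis+
    then have "C = D" using xy twin_class_eq_iff twin_carrier by metis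
    then show ?thesis using CD by simp
  qed
  have cT: "c \<subseteq> T"
  proof
    fix w assume "w \<in> c"
    then have "w \<in> carrier G" "twin_class G w = {w}" using c by (auto simp: lone_involution_def)
    then have "{w} \<in> twin_classes G" using twin_class_in_classes by metis
    then show "w \<in> T" using rep[of "{w}"] unfolding T_def by force
  qed
  let ?S = "carrier G - (T - c)"
  have "resolves ?S"
    unfolding resolves_def
  proof (intro conjI ballI impI notI)
    show "?S \<subseteq> carrier G" by blast
    fix x y assume x: "x \<in> carrier G" and y: "y \<in> carrier G" and ne: "x \<noteq> y"
      and "resolvers G x y \<inter> ?S = {}"
    then have RT: "resolvers G x y \<subseteq> T - c"
      by (auto simp: resolvers_def)
    have xyR: "x \<in> resolvers G x y" "y \<in> resolvers G x y"
      using x y ne by (auto simp: resolvers_iff)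
    have "critical x y"
      unfolding critical_def
    proof (intro conjI ballI)
      show "\<not> x \<simeq> y" using T_eq xyR RT ne by blast
      fix z assume z: "z \<in> resolvers G x y - {x, y}"
      then have zG: "z \<in> carrier G" using x y by (auto simp: resolvers_iff)
      \<comment> \<open>A twin v of z other than z lies outside T, so it differs from x and y and
        would be a further resolver, whereas all resolvers lie in T.\<close>
      have lone: "v = z" if "z \<simeq> v" for v
      proof (rule ccontr)
        assume "v \<noteq> z"
        then have "v \<notin> T" using T_eq that z RT by blast
        then have "v \<notin> {x, y}" using xyR RT by blast
        then have "v \<in> resolvers G x y"
          using resolvers_closed_under_twin[OF x y _ that] z by blast
        then show False using \<open>v \<notin> T\<close> RT by blast
      qed
      have "z \<simeq> inv z"
        using zG spans_inv[of z] spans_inv[of "inv z"] by (intro twin_if_spans_both) auto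
      then have "inv z = z" by (rule lone)
      then have "ord z = 1 \<or> ord z = 2" using zG inv_eq_self_iff by blast
      moreover have "z \<noteq> \<one>"
      proof
        assume "z = \<one>"
        then have "x \<frown> z" "y \<frown> z" using z x y adj_one by auto
        then show False using z x y resolvers_iff[OF x y] by blast
      qed
      ultimately show "lone_involution z"
        using zG lone twin_refl[OF zG] ord_eq_1[OF zG]
        by (auto simp: lone_involution_def twin_class_iff)
    qed (fact x y)+
    then show False using crit RT by blast
  qed
  moreover have "card ?S = order G - card (twin_classes G) + card c"
  proof -
    have fin: "finite T" "finite c"
      using TG cT finite_carrier by (auto intro: finite_subset)
    have "card ?S = order G - card (T - c)"
      using TG finite_carrier fin by (subst card_Diff_subset) (auto simp: order_def)
    also have "card (T - c) = card T - card c"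
      using cT fin by (simp add: card_Diff_subset)
    also have "order G - (card T - card c) = order G - card T + card c"
      using card_mono[OF finite_carrier TG] card_mono[OF fin(1) cT] by (simp add: order_def)
    finally show ?thesis by (simp add: cardT)
  qed
  ultimately show thesis using that by blast
qed

section \<open>Critical pairs\<close>

lemma criticalD:
  assumes "critical x y"
  shows "x \<in> carrier G" "y \<in> carrier G" "\<not> x \<simeq> y"
    "\<And>z. z \<in> resolvers G x y - {x, y} \<Longrightarrow> lone_involution z"
  using assms by (auto simp: critical_def)

lemma lone_involutionD:
  assumes "lone_involution w"
  shows "w \<in> carrier G" "ord w = 2" "w \<noteq> \<one>" "\<And>v. w \<simeq> v \<Longrightarrow> v = w"
proof -
  show *: "w \<in> carrier G" "ord w = 2" using assms by (auto simp: lone_involution_def)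
  show "w \<noteq> \<one>" using * by auto
  show "v = w" if "w \<simeq> v" for v
    using assms that twin_class_iff[of v w] by (simp add: lone_involution_def)
qed

lemma critical_sym: "critical x y \<Longrightarrow> critical y x"
  using twin_sym by (auto simp: critical_def resolvers_commute[of y x])

lemma critical_cases:
  assumes "critical x y" "z \<in> carrier G" "z \<noteq> x" "z \<noteq> y"
  shows "(x \<frown> z \<longleftrightarrow> y \<frown> z) \<or> (z \<in> resolvers G x y - {x, y} \<and> lone_involution z)"
  using assms criticalD[OF assms(1)] resolvers_iff[of x y z] twin_refl by blast

lemma critical_resolver_nonempty:
  assumes "critical x y" shows "resolvers G x y - {x, y} \<noteq> {}"
proof -
  have xy: "x \<in> carrier G" "y \<in> carrier G" "x \<noteq> y" using criticalD[OF assms] twin_refl by auto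
  obtain z where z: "z \<noteq> x" "z \<noteq> y" "x \<frown> z \<longleftrightarrow> \<not> y \<frown> z"
    using criticalD[OF assms] twin_iff by blast
  then have "z \<in> carrier G" by (auto simp: adj_def)
  then show ?thesis using z xy resolvers_iff by blast
qed

text \<open>Only x and x' themselves are in doubt. If they differ, x' is not a lone involution, so
  by criticality x' does not separate x from y, and symmetrically x does not separate x' from
  y.\<close>

lemma resolvers_diff_twin:
  assumes c: "critical x y" and t: "x \<simeq> x'"
  shows "resolvers G x' y - {x', y} = resolvers G x y - {x, y}"
proof (cases "x' = x")
  case False
  have G: "x \<in> carrier G" "y \<in> carrier G" "x' \<in> carrier G"
    using criticalD[OF c] twin_carrier[OF t] by auto
  have ne: "x \<noteq> y" "x' \<noteq> y"
    using criticalD[OF c] t twin_refl G by auto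
  have "\<not> lone_involution x'"
    using lone_involutionD(4) twin_sym[OF t] False by blast
  then have "x \<frown> x' \<longleftrightarrow> y \<frown> x'" and x': "x' \<notin> resolvers G x y - {x, y}"
    using critical_cases[OF c G(3)] False ne criticalD(4)[OF c] by blast+
  moreover have "x \<frown> y \<longleftrightarrow> x' \<frown> y"
    using twin_adj_iff[OF t] ne by auto
  ultimately have x: "x \<notin> resolvers G x' y - {x', y}"
    using False ne G by (metis DiffD1 DiffD2 adj_sym insertCI resolvers_iff)
  have "z \<in> resolvers G x' y \<longleftrightarrow> z \<in> resolvers G x y" if "z \<noteq> x" "z \<noteq> x'" for z
    using twin_adj_iff[OF t that] that resolvers_iff G ne by metis
  then have "z \<in> resolvers G x' y - {x', y} \<longleftrightarrow> z \<in> resolvers G x y - {x, y}" for z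
    using x x' by (cases "z = x \<or> z = x'") auto
  then show ?thesis by blast
qed simp

lemma critical_twin:
  assumes c: "critical x y" and t: "x \<simeq> x'"
  shows "critical x' y"
  using c resolvers_diff_twin[OF c t] twin_carrier[OF t] twin_trans[OF t]
  by (auto simp: critical_def)

text \<open>Each critical pair forces a whole class into S. If neither the class of x nor that of y
  lies in S, twins x', y' outside S must be separated by a third vertex in S; it is a lone
  involution, and its class is a singleton.\<close>

lemma critical_blocks:
  assumes S: "resolves S" and c: "critical x y"
  obtains t where "t \<in> insert x (insert y (resolvers G x y))" "t \<in> carrier G" "twin_class G t \<subseteq> S"
proof -
  have G: "x \<in> carrier G" "y \<in> carrier G" using criticalD[OF c] by auto
  show thesis
  proof (cases "twin_class G x \<subseteq> S \<or> twin_class G y \<subseteq> S")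
    case True then show ?thesis using that G by blast
  next
    case False
    then obtain x' y' where x': "x \<simeq> x'" "x' \<notin> S" and y': "y \<simeq> y'" "y' \<notin> S"
      using twin_class_iff by blast
    have c': "critical x' y" using critical_twin[OF c x'(1)] .
    have "resolvers G x' y' - {x', y'} = resolvers G x' y - {x', y}"
      using resolvers_diff_twin[OF critical_sym[OF c'] y'(1)]
      by (simp add: resolvers_commute insert_commute)
    also have "\<dots> = resolvers G x y - {x, y}"
      using resolvers_diff_twin[OF c x'(1)] .
    finally have R: "resolvers G x' y' - {x', y'} = resolvers G x y - {x, y}" .
    have "x' \<noteq> y'"
      using x' y' criticalD(3)[OF c] twin_sym twin_trans by blast
    then obtain w where w: "w \<in> resolvers G x' y'" "w \<in> S"
      using S twin_carrier x' y' unfolding resolves_def by blast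
    then have wR: "w \<in> resolvers G x y - {x, y}" using R x' y' by blast
    then have "lone_involution w" using criticalD(4)[OF c] by blast
    then show ?thesis
      using that[of w] wR w by (auto simp: lone_involution_def)
  qed
qed

lemma involution_not_adj:
  assumes "u \<in> carrier G" "v \<in> carrier G" "ord u = 2" "ord v = 2" shows "\<not> u \<frown> v"
  using assms spanned_by_involution[of u v] spanned_by_involution[of v u] by (auto simp: adj_def)

lemma involution_adjD:
  assumes "w \<in> carrier G" "ord w = 2" "w \<frown> z" "z \<noteq> \<one>"
  shows "z \<in> carrier G" "z \<unrhd> w" "ord z \<noteq> 2"
  using assms spanned_by_involution[of w z] involution_not_adj[of w z] by (auto simp: adj_def)

text \<open>If x has order above 2, then \<open>inv x\<close> is a neighbour of x that cannot
  separate x from y, so y is adjacent to \<open>inv x\<close> and therefore comparable with x. Two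
  involutions cannot form a critical pair, because a third involution is adjacent to
  neither.\<close>

lemma critical_imp_adj:
  assumes c: "critical x y" shows "x \<frown> y"
proof -
  have *: "x \<frown> y" if c: "critical x y" and o: "ord x \<noteq> 1" "ord x \<noteq> 2" for x y
  proof -
    have G: "x \<in> carrier G" "y \<in> carrier G" "x \<noteq> y" using criticalD[OF c] twin_refl by auto
    have i: "inv x \<in> carrier G" "inv x \<noteq> x" "x \<unrhd> inv x" "inv x \<unrhd> x"
      using G o inv_eq_self_iff spans_inv[of x] spans_inv[of "inv x"] by auto
    have "inv x \<noteq> y" using twin_if_spans_both i G criticalD[OF c] by blast
    moreover have "\<not> lone_involution (inv x)" using G o by (simp add: lone_involution_def)
    moreover have "x \<frown> inv x" using G i by (auto simp: adj_def)
    ultimately have "y \<frown> inv x" using critical_cases[OF c, of "inv x"] i by auto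
    then show ?thesis
      using G i unfolding adj_def by (metis spans_trans)
  qed
  have G: "x \<in> carrier G" "y \<in> carrier G" "x \<noteq> y" using criticalD[OF c] twin_refl by auto
  consider "ord x \<noteq> 1 \<and> ord x \<noteq> 2" | "ord y \<noteq> 1 \<and> ord y \<noteq> 2" | "x = \<one>" | "y = \<one>" | "ord x = 2" "ord y = 2"
    using G ord_eq_1 by blast
  then show ?thesis
  proof cases
    case 1 then show ?thesis using * c by blast
  next
    case 2 then show ?thesis using * critical_sym[OF c] adj_sym by blast
  next
    case 3 then show ?thesis using adj_one adj_sym G by blast
  next
    case 4 then show ?thesis using adj_one G by blast
  next
    case 5
    obtain z where z: "z \<in> resolvers G x y - {x, y}" using critical_resolver_nonempty[OF c] by blast
    then have "ord z = 2" "z \<in> carrier G" using criticalD(4)[OF c] lone_involutionD by blast+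
    then have "\<not> x \<frown> z" "\<not> y \<frown> z" using involution_not_adj G 5 by auto
    then show ?thesis using z G by (auto simp: resolvers_iff)
  qed
qed

section \<open>Critical pairs containing the identity\<close>

lemma conj_pow:
  assumes "g \<in> carrier G" "z \<in> carrier G"
  shows "(g \<otimes> z \<otimes> inv g) [^] (n::nat) = g \<otimes> z [^] n \<otimes> inv g"
proof (induction n)
  case 0 then show ?case using assms by simp
next
  case (Suc n)
  have "(g \<otimes> z [^] n \<otimes> inv g) \<otimes> (g \<otimes> z \<otimes> inv g) = g \<otimes> z [^] n \<otimes> (inv g \<otimes> g) \<otimes> z \<otimes> inv g"
    using assms by (simp only: m_assoc m_closed inv_closed nat_pow_closed)
  then show ?case using Suc assms by (simp add: m_assoc)
qed

lemma conj_spans: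
  assumes "g \<in> carrier G" "z \<in> carrier G" "z \<unrhd> v"
  shows "g \<otimes> z \<otimes> inv g \<unrhd> g \<otimes> v \<otimes> inv g"
  using assms conj_pow unfolding spans_def by metis

lemma conj_adj:
  assumes g: "g \<in> carrier G" and "z \<frown> v"
  shows "g \<otimes> z \<otimes> inv g \<frown> g \<otimes> v \<otimes> inv g"
  using assms conj_spans[OF g] unfolding adj_def by auto

text \<open>Conjugates of a pendant involution are pendant, hence its twins.\<close>

lemma pendant_lone_involution_central:
  assumes w: "lone_involution w" and pend: "\<And>z. w \<frown> z \<Longrightarrow> z = \<one>" and g: "g \<in> carrier G"
  shows "g \<otimes> w = w \<otimes> g"
proof -
  let ?v = "g \<otimes> w \<otimes> inv g"
  have wG: "w \<in> carrier G" "w \<noteq> \<one>" using lone_involutionD[OF w] by auto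
  have vG: "?v \<in> carrier G" using wG g by simp
  have cancel: "inv g \<otimes> (g \<otimes> z \<otimes> inv g) \<otimes> g = z" if "z \<in> carrier G" for z
    using that g by (simp add: m_assoc) (simp flip: m_assoc)
  have cancel': "g \<otimes> (inv g \<otimes> z \<otimes> g) \<otimes> inv g = z" if "z \<in> carrier G" for z
    using that g by (simp add: m_assoc) (simp flip: m_assoc)
  have v1: "?v \<noteq> \<one>"
    using cancel[OF wG(1)] g wG by auto
  have pend_v: "z = \<one>" if z: "?v \<frown> z" for z
  proof -
    have zG: "z \<in> carrier G" using z by (simp add: adj_def)
    have "w \<frown> inv g \<otimes> z \<otimes> g"
      using conj_adj[of "inv g", OF _ z] g wG cancel by simp
    then have "inv g \<otimes> z \<otimes> g = \<one>" by (rule pend)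
    then show ?thesis using g
      using cancel'[OF zG] by simp
  qed
  have "w \<frown> z \<longleftrightarrow> ?v \<frown> z" for z
    using pend pend_v adj_one wG vG v1 by metis
  then have "w \<simeq> ?v" using wG vG by (simp add: twin_iff)
  then have "?v = w" by (rule lone_involutionD(4)[OF w])
  then show ?thesis using g wG by (metis inv_solve_right m_closed)
qed

text \<open>The identity is adjacent to z, so a z that does not separate it from x is adjacent to x
  as well.\<close>

lemma critical_one_adj:
  assumes c: "critical x \<one>" and z: "z \<in> carrier G" "z \<noteq> x" "z \<noteq> \<one>" "\<not> lone_involution z"
  shows "x \<frown> z"
  using critical_cases[OF c] adj_one adj_sym z by blast

text \<open>If \<open>\<langle>x\<rangle>\<close> contained an involution \<open>u\<close>, every other involution \<open>w\<close>
  would be pendant; then \<open>w\<close> is central and \<open>u w\<close> is another pendant involution.\<close>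

lemma critical_one_odd:
  assumes c: "critical x \<one>" shows "odd (ord x)"
proof
  assume ev: "even (ord x)"
  have xG: "x \<in> carrier G" "x \<noteq> \<one>" using criticalD[OF c] twin_refl by auto
  obtain u where u: "u \<in> carrier G" "x \<unrhd> u" "ord u = 2"
    using exists_spanned_of_ord[OF xG(1) ev] by blast
  have pend: "z = \<one>" if v: "v \<in> carrier G" "ord v = 2" "v \<noteq> u" and vz: "v \<frown> z" for v z
  proof (rule ccontr)
    assume z1: "z \<noteq> \<one>"
    \<comment> \<open>Such a z is comparable with x. If x generates z, the cyclic group of x
      contains both u and v; if z generates x, the cyclic group of z does.\<close>
    have z: "z \<in> carrier G" "z \<unrhd> v" "ord z \<noteq> 2" using involution_adjD[OF v(1,2) vz z1] by auto
    have "\<not> x \<unrhd> v" using unique_spanned_involution[of x u v] u v xG by auto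
    then have "\<not> x \<unrhd> z" "z \<noteq> x" using spans_trans xG z by blast+
    moreover have "\<not> z \<unrhd> x"
      using unique_spanned_involution[of z u v] spans_trans[of z x u] u v z by auto
    moreover have "z = x \<or> x \<frown> z"
      using critical_one_adj[OF c] z z1 lone_involutionD(2) by blast
    ultimately show False by (auto simp: adj_def)
  qed
  obtain w where w: "w \<in> resolvers G x \<one> - {x, \<one>}" using critical_resolver_nonempty[OF c] by blast
  then have lw: "lone_involution w" using criticalD(4)[OF c] by blast
  note lwD = lone_involutionD[OF lw]
  have "\<one> \<frown> w" using lwD adj_one adj_sym by blast
  then have "\<not> x \<frown> w" using w xG by (auto simp: resolvers_iff)
  then have wu: "w \<noteq> u" using w u xG by (auto simp: adj_def)
  have comm: "u \<otimes> w = w \<otimes> u"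
    using pendant_lone_involution_central[OF lw] pend[OF lwD(1,2) wu] u by blast
  let ?v = "u \<otimes> w"
  have vG: "?v \<in> carrier G" using u lwD by simp
  have "inv u = u" "inv w = w" using u lwD inv_eq_self_iff by auto
  have "u \<noteq> \<one>" using u by auto
  then have vne: "?v \<noteq> u" "?v \<noteq> w" using u lwD by auto
  have "?v \<noteq> \<one>" using inv_equality[of u w] \<open>inv w = w\<close> u lwD wu by auto
  have "inv ?v = ?v" using \<open>inv u = u\<close> \<open>inv w = w\<close> comm u lwD by (simp add: inv_mult_group)
  then have v2: "ord ?v = 2" using inv_eq_self_iff[OF vG] \<open>?v \<noteq> \<one>\<close> ord_eq_1[OF vG] by auto
  \<comment> \<open>Both w and u w have the identity as their only neighbour, which makes them twins
    although w is lone.\<close>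
  have "w \<frown> z \<longleftrightarrow> ?v \<frown> z" for z
    using pend[OF lwD(1,2) wu] pend[OF vG v2 vne(1)] adj_one lwD vG \<open>?v \<noteq> \<one>\<close> by metis
  then have "w \<simeq> ?v" using lwD vG by (simp add: twin_iff)
  then show False using lwD(4) vne by blast
qed

text \<open>Since x has odd order, it is incomparable with w, so w separates x from the identity.
  For commutation, either w is pendant and hence central, or some further neighbour z of w is
  comparable with x and generates both x and w.\<close>

lemma critical_one_involution:
  assumes c: "critical x \<one>" and w: "w \<in> carrier G" "ord w = 2"
  shows "lone_involution w" "w \<in> resolvers G x \<one> - {x, \<one>}" "x \<otimes> w = w \<otimes> x"
proof -
  have xG: "x \<in> carrier G" "x \<noteq> \<one>" using criticalD[OF c] twin_refl by auto
  have xw: "\<not> x \<unrhd> w" using ord_dvd_if_spans[OF xG(1), of w] w critical_one_odd[OF c] by auto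
  moreover have ne: "w \<noteq> x" "w \<noteq> \<one>" using w critical_one_odd[OF c] by auto
  ultimately have na: "\<not> x \<frown> w" using spanned_by_involution[OF w, of x] xG by (auto simp: adj_def)
  then show lw: "lone_involution w" using critical_one_adj[OF c w(1)] ne by blast
  show "w \<in> resolvers G x \<one> - {x, \<one>}"
    using na ne w xG adj_one[of w] adj_sym[of w \<one>] by (auto simp: resolvers_iff)
  show "x \<otimes> w = w \<otimes> x"
  proof (cases "\<exists>z. w \<frown> z \<and> z \<noteq> \<one>")
    case False
    then show ?thesis using pendant_lone_involution_central[OF lw] xG by blast
  next
    case True
    then obtain z where wz: "w \<frown> z" and z1: "z \<noteq> \<one>" by blast
    have z: "z \<in> carrier G" "z \<unrhd> w" "ord z \<noteq> 2" using involution_adjD[OF w wz z1] by auto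
    have "z \<noteq> x" using z xw by blast
    then have "x \<frown> z" using critical_one_adj[OF c z(1)] z z1 lone_involutionD(2) by blast
    then have "z \<unrhd> x" using xw spans_trans[OF xG(1)] z unfolding adj_def by blast
    then show ?thesis using spans_commute[of z x w] z by blast
  qed
qed

lemma critical_one_exists_involution:
  assumes "critical x \<one>" obtains w where "lone_involution w"
  using critical_resolver_nonempty[OF assms] criticalD(4)[OF assms] by blast

text \<open>Take a power u of x of prime order p and an involution w. The element u w of order 2p is
  comparable with x but is no power of it, as \<open>ord x\<close> is odd; so \<open>ord x\<close>
  divides 2p and equals p.\<close>

lemma critical_one_prime:
  assumes c: "critical x \<one>" shows "prime (ord x)"
proof -
  have xG: "x \<in> carrier G" "x \<noteq> \<one>" using criticalD[OF c] twin_refl by auto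
  obtain w where "lone_involution w" using critical_one_exists_involution[OF c] .
  then have w: "w \<in> carrier G" "ord w = 2" using lone_involutionD by auto
  obtain p where p: "prime p" "p dvd ord x"
    using prime_factor_nat xG ord_eq_1 by blast
  obtain u where u: "u \<in> carrier G" "x \<unrhd> u" "ord u = p"
    using exists_spanned_of_ord[OF xG(1) p(2)] .
  have odd: "odd (ord u)" using p u critical_one_odd[OF c] by (metis dvd_trans)
  have comm: "u \<otimes> w = w \<otimes> u"
  proof -
    have "x \<otimes> w \<unrhd> x" "x \<otimes> w \<unrhd> w"
      using mult_involution_spans[OF xG(1) critical_one_odd[OF c] w critical_one_involution(3)[OF c w]] by auto
    then show ?thesis using spans_commute[of "x \<otimes> w" u w] spans_trans[of "x \<otimes> w" x u] u w xG by auto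
  qed
  let ?z = "u \<otimes> w"
  have z: "?z \<in> carrier G" "?z \<unrhd> w" "ord ?z = 2 * p"
    using mult_involution_spans[OF u(1) odd w comm] u w by auto
  have nx: "\<not> x \<unrhd> ?z"
    using ord_dvd_if_spans[OF xG(1)] z critical_one_odd[OF c] by (metis dvd_mult_left)
  have "?z \<noteq> x" using nx spans_refl xG by metis
  moreover have "?z \<noteq> \<one>" "ord ?z \<noteq> 2" using z p by (auto simp: prime_nat_iff)
  ultimately have "x \<frown> ?z" using critical_one_adj[OF c z(1)] lone_involutionD(2) by blast
  then have "ord x dvd 2 * p" using nx ord_dvd_if_spans z unfolding adj_def by metis
  then have "ord x dvd p" using critical_one_odd[OF c]
    by (simp add: coprime_dvd_mult_right_iff)
  then show ?thesis using p by (metis dvd_antisym)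
qed

lemma cyclic_unique_involution:
  assumes "cyclic_group G" "u \<in> carrier G" "v \<in> carrier G" "ord u = 2" "ord v = 2"
  shows "u = v"
proof -
  obtain g where g: "g \<in> carrier G" "carrier G = range (\<lambda>n::int. g [^] n)"
    using assms(1) cyclic_group by blast
  have "g \<unrhd> h" if h: "h \<in> carrier G" for h
  proof -
    obtain n :: int where "h = g [^] n" using h g by blast
    \<comment> \<open>Integer exponents are reduced modulo the order of g to become natural.\<close>
    also have "\<dots> = g [^] (n mod int (ord g))"
      using g int_pow_eq[of g n "n mod int (ord g)"] by (simp add: mod_eq_dvd_iff[symmetric])
    also have "\<dots> = g [^] nat (n mod int (ord g))"
      using ord_pos[of g] g by (simp flip: int_pow_int)
    finally show ?thesis by (simp add: spans_pow)
  qed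
  then show ?thesis using unique_spanned_involution[of g u v] assms g by blast
qed

lemma generate_singleton_iff: "x \<in> carrier G \<Longrightarrow> y \<in> generate G {x} \<longleftrightarrow> x \<unrhd> y"
  using generate_pow_nat[of x] ord_pos[of x] by (auto simp: spans_def)

text \<open>With p = \<open>ord x\<close>, all conditions come from \<open>cmp\<close>: every
  element that is no involution is comparable with x. For an involution v, the product x v generates
  the cyclic subgroup of order 2p.\<close>

lemma critical_one_Psi:
  assumes c: "critical x \<one>" and nc: "\<not> cyclic_group G"
  shows "G \<in> Psi"
proof -
  define p where "p = ord x"
  have xG: "x \<in> carrier G" "x \<noteq> \<one>" using criticalD[OF c] twin_refl by auto
  have p: "prime p" "odd p" using critical_one_prime[OF c] critical_one_odd[OF c] by (auto simp: p_def)
  obtain w where "lone_involution w" using critical_one_exists_involution[OF c] .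
  then have w: "w \<in> carrier G" "ord w = 2" using lone_involutionD by auto
  have cmp: "x \<unrhd> z \<or> z \<unrhd> x" if "z \<in> carrier G" "ord z \<noteq> 2" for z
    using critical_one_adj[OF c, of z] that lone_involutionD(2)[of z] spans_one spans_refl[OF xG(1)]
    by (cases "z = x \<or> z = \<one>") (auto simp: adj_def)
  have pf: "prime_factors (order G) = {2, p}"
  proof
    show "{2, p} \<subseteq> prime_factors (order G)"
      using p ord_dvd_group_order[OF w(1)] ord_dvd_group_order[OF xG(1)] w order_gt_0_iff_finite finite_carrier
      by (auto simp: prime_factors_dvd p_def)
    show "prime_factors (order G) \<subseteq> {2, p}"
    proof
      fix q assume "q \<in> prime_factors (order G)"
      then have q: "prime q" "q dvd order G" by auto
      obtain z where z: "z \<in> carrier G" "ord z = q" using cauchy[OF q] .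
      show "q \<in> {2, p}"
      proof (cases "q = 2")
        case False
        then have "x \<unrhd> z \<or> z \<unrhd> x" using cmp z by auto
        then have "q dvd p \<or> p dvd q" using ord_dvd_if_spans z xG by (auto simp: p_def)
        then show ?thesis using p q primes_dvd_imp_eq by blast
      qed simp
    qed
  qed
  have gen: "subgroup (generate G {x}) G" "card (generate G {x}) = p"
    using xG generate_is_subgroup[of "{x}"] generate_pow_card[of x] by (auto simp: p_def)
  have uniq: "H = generate G {x}" if H: "subgroup H G" "card H = p" for H
  proof (rule card_subset_eq)
    show "finite (generate G {x})" using gen p by (auto intro: card_ge_0_finite simp: prime_gt_0_nat)
    show "H \<subseteq> generate G {x}"
    proof
      fix h assume h: "h \<in> H"
      have hG: "h \<in> carrier G" using h H subgroup.mem_carrier by metis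
      have "ord h dvd p" using ord_dvd_card_subgroup H h by metis
      then consider "h = \<one>" | "ord h = p" using p hG ord_eq_1 by (metis prime_nat_iff)
      then have "x \<unrhd> h"
      proof cases
        case 1 then show ?thesis by (simp add: spans_one)
      next
        case 2
        moreover have "p \<noteq> 2" using p by auto
        ultimately have "x \<unrhd> h \<or> h \<unrhd> x" using cmp hG by blast
        then show ?thesis using spans_sym_if_ord_eq[of h x] 2 hG p_def by metis
      qed
      then show "h \<in> generate G {x}" using generate_singleton_iff xG by blast
    qed
    show "card H = card (generate G {x})" using H gen by simp
  qed
  have no4: "ord z \<noteq> 4" if z: "z \<in> carrier G" for z
  proof
    assume 4: "ord z = 4"
    then have "x \<unrhd> z \<or> z \<unrhd> x" using cmp z by auto
    then have "4 dvd p \<or> p dvd 2 ^ 2"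
      using ord_dvd_if_spans[OF xG(1), of z] ord_dvd_if_spans[OF z, of x] 4 by (auto simp: p_def)
    moreover have "\<not> 4 dvd p" using p by (metis dvd_trans even_numeral)
    ultimately have "p dvd 2" using p(1) prime_dvd_power by blast
    then show False using p by (metis primes_dvd_imp_eq two_is_prime_nat dvd_refl)
  qed
  have C4: "\<exists>H. subgroup H G \<and> cyclic_group (G\<lparr>carrier := H\<rparr>) \<and> card H = 2 * p \<and> v \<in> H"
    if v: "v \<in> carrier G" "ord v = 2" for v
  proof -
    let ?z = "x \<otimes> v"
    have z: "?z \<in> carrier G" "?z \<unrhd> v" "ord ?z = 2 * p"
      using mult_involution_spans[OF xG(1) critical_one_odd[OF c] v critical_one_involution(3)[OF c v]] xG v
      by (auto simp: p_def)
    have "cyclic_group (G\<lparr>carrier := generate G {?z}\<rparr>)"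
      using cyclic_group_generated[of ?z] z by (simp add: subgroup_generated_def)
    then show ?thesis
      using z generate_is_subgroup[of "{?z}"] generate_pow_card[of ?z] generate_singleton_iff[of ?z v]
      by (intro exI[of _ "generate G {?z}"]) auto
  qed
  show ?thesis
    unfolding Psi_def
  proof (intro CollectI conjI exI[of _ p] ballI impI)
    show "\<exists>!H. subgroup H G \<and> card H = p" using gen uniq by blast
  qed (use is_group finite_carrier nc p pf no4 C4 in auto)
qed

section \<open>Critical pairs without the identity\<close>

text \<open>A third resolver is an involution, so it cannot generate y; it must be a power of x and
  no power of y. The cyclic group of x has only one involution w, and as w is no power of y, the
  order of y is odd.\<close>

lemma critical_nontrivial:
  assumes c: "critical x y" and xy: "x \<unrhd> y" and y1: "y \<noteq> \<one>"
  obtains w where "resolvers G x y - {x, y} = {w}" "lone_involution w" "x \<unrhd> w"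
    "prime (ord y)" "odd (ord y)"
proof -
  have G: "x \<in> carrier G" "y \<in> carrier G" "x \<noteq> y" using criticalD[OF c] twin_refl by auto
  have R: "lone_involution z \<and> x \<unrhd> z \<and> x \<frown> z \<and> \<not> y \<frown> z" if z: "z \<in> resolvers G x y - {x, y}" for z
  proof -
    have lz: "lone_involution z" using criticalD(4)[OF c z] .
    note lzD = lone_involutionD[OF lz]
    have zy: "\<not> z \<unrhd> y" using spanned_by_involution[OF lzD(1,2)] y1 z by blast
    then have zx: "\<not> z \<unrhd> x" using spans_trans[OF lzD(1)] xy by blast
    have "\<not> y \<frown> z"
      using zy z G xy spans_trans[OF G(1) xy, of z] lzD resolvers_iff[OF G(1,2), of z]
      unfolding adj_def by blast
    then show ?thesis using lz z G zx resolvers_iff[OF G(1,2), of z] unfolding adj_def by blast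
  qed
  obtain w where w: "w \<in> resolvers G x y - {x, y}" using critical_resolver_nonempty[OF c] by blast
  have lw: "lone_involution w" and xw: "x \<unrhd> w" and yw: "\<not> y \<frown> w" using R[OF w] by auto
  have Rw: "resolvers G x y - {x, y} = {w}"
    using R w unique_spanned_involution[OF G(1) _ xw] lone_involutionD(2) lw by blast
  have odd: "odd (ord y)"
  proof
    assume "even (ord y)"
    then obtain u where u: "u \<in> carrier G" "y \<unrhd> u" "ord u = 2" using exists_spanned_of_ord[OF G(2)] by blast
    then have "u = w"
      using unique_spanned_involution[OF G(1) _ xw] spans_trans[OF G(1) xy] lone_involutionD(2)[OF lw] by blast
    then show False using yw u w G by (auto simp: adj_def)
  qed
  obtain p where p: "prime p" "p dvd ord y" using prime_factor_nat y1 G ord_eq_1 by blast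
  have podd: "odd p" using p odd by (metis dvd_trans)
  have "2 * p dvd ord x"
  proof (rule divides_mult)
    show "2 dvd ord x" using ord_dvd_if_spans[OF G(1) xw] lone_involutionD(2)[OF lw] by simp
    show "p dvd ord x" using ord_dvd_if_spans[OF G(1) xy] p by (metis dvd_trans)
    show "coprime 2 p" using podd by simp
  qed
  \<comment> \<open>Having order 2p, v is not a lone involution and cannot separate x from y. So it
    generates y, and the odd number \<open>ord y\<close> divides 2p.\<close>
  then obtain v where v: "v \<in> carrier G" "x \<unrhd> v" "ord v = 2 * p" using exists_spanned_of_ord[OF G(1)] by blast
  have v2: "\<not> lone_involution v" using v p by (auto dest: lone_involutionD(2) simp: prime_nat_iff)
  have "v \<unrhd> y"
  proof (cases "v = x")
    case False
    have "v \<noteq> y" using v odd by auto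
    moreover have "x \<frown> v" using v False G by (auto simp: adj_def)
    ultimately have "y \<frown> v" using critical_cases[OF c v(1)] False v2 by blast
    moreover have "\<not> y \<unrhd> v" using ord_dvd_if_spans[OF G(2), of v] v odd by (metis dvd_mult_left)
    ultimately show ?thesis by (auto simp: adj_def)
  qed (use xy in simp)
  then have "ord y dvd 2 * p" using ord_dvd_if_spans v by metis
  then have "ord y dvd p" using odd by (simp add: coprime_dvd_mult_right_iff)
  then have "ord y = p" using p by (metis dvd_antisym)
  then show thesis using that[OF Rw lw xw] p odd by simp
qed

section \<open>The metric dimension\<close>

text \<open>The definition of a resolving involution does not say that w is lone, but a twin of w
  would lie outside {x, y} and be a further resolver.\<close>

lemma mem_resolving_involutions_iff:
  "w \<in> resolving_involutions G \<longleftrightarrow> (\<exists>x y. critical x y \<and> resolvers G x y - {x, y} = {w})"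
proof
  assume "w \<in> resolving_involutions G"
  then obtain x y where w: "w \<in> carrier G" "ord w = 2" and x: "x \<in> carrier G" "\<not> w \<simeq> x"
    and y: "y \<in> carrier G" "\<not> w \<simeq> y" and R: "resolvers G x y = {x, y, w}"
    by (auto simp: resolving_involutions_def twin_class_iff)
  have ne: "w \<noteq> x" "w \<noteq> y" using x y twin_refl w by auto
  then have Rd: "resolvers G x y - {x, y} = {w}" using R by blast
  have "v = w" if "w \<simeq> v" for v
  proof -
    have "v \<notin> {x, y}" using that x y by auto
    then have "v \<in> resolvers G x y"
      using resolvers_closed_under_twin[OF x(1) y(1) _ that] R ne by auto
    then show ?thesis using R \<open>v \<notin> {x, y}\<close> by blast
  qed
  then have "lone_involution w"
    using w twin_refl by (auto simp: lone_involution_def twin_class_iff)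
  moreover have "\<not> x \<simeq> y" using resolvers_twin R ne by blast
  ultimately have "critical x y" using x(1) y(1) by (simp add: critical_def Rd)
  then show "\<exists>x y. critical x y \<and> resolvers G x y - {x, y} = {w}"
    using Rd by blast
next
  assume "\<exists>x y. critical x y \<and> resolvers G x y - {x, y} = {w}"
  then obtain x y where c: "critical x y" and R: "resolvers G x y - {x, y} = {w}" by blast
  have G: "x \<in> carrier G" "y \<in> carrier G" "x \<noteq> y" using criticalD[OF c] twin_refl by auto
  have lw: "lone_involution w" using criticalD(4)[OF c] R by blast
  have "{x, y} \<subseteq> resolvers G x y" using G by (simp add: resolvers_iff)
  then have "resolvers G x y = {x, y, w}" using R by blast
  moreover have "x \<notin> twin_class G w" "y \<notin> twin_class G w"
    using R lw by (auto simp: lone_involution_def)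
  ultimately show "w \<in> resolving_involutions G"
    using G lw by (auto simp: resolving_involutions_def lone_involution_def)
qed

section \<open>Groups in \<open>Psi\<close>\<close>

text \<open>Restates membership in \<open>Psi\<close> through elements. Here y generates the unique
  subgroup of order p, which lies in the cyclic group of every nontrivial element that is no
  involution.\<close>

lemma PsiE:
  assumes "G \<in> Psi"
  obtains p y w0 where "prime p" "odd p" "y \<in> carrier G" "ord y = p"
    "\<And>z. z \<in> carrier G \<Longrightarrow> z \<noteq> \<one> \<Longrightarrow> ord z \<noteq> 2 \<Longrightarrow> z \<unrhd> y"
    "\<And>w. w \<in> carrier G \<Longrightarrow> ord w = 2 \<Longrightarrow> \<exists>z \<in> carrier G. ord z = 2 * p \<and> z \<unrhd> w"
    "w0 \<in> carrier G" "ord w0 = 2"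
proof -
  obtain p where p: "prime p" "odd p" and pf: "prime_factors (order G) = {2, p}"
    and uniq: "\<exists>!H. subgroup H G \<and> card H = p"
    and no4: "\<forall>x \<in> carrier G. ord x \<noteq> 4"
    and C4: "\<forall>w \<in> carrier G. ord w = 2 \<longrightarrow>
      (\<exists>H. subgroup H G \<and> cyclic_group (G\<lparr>carrier := H\<rparr>) \<and> card H = 2 * p \<and> w \<in> H)"
    using assms unfolding Psi_def mem_Collect_eq by (elim conjE exE) (rule that)
  have dvd: "2 dvd order G" "p dvd order G"
    using pf by (metis in_prime_factors_iff insertCI)+
  obtain y where y: "y \<in> carrier G" "ord y = p" using cauchy[OF p(1) dvd(2)] .
  have gen: "subgroup (generate G {h}) G \<and> card (generate G {h}) = p"
    if "h \<in> carrier G" "ord h = p" for h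
    using that generate_is_subgroup[of "{h}"] generate_pow_card[of h] by auto
  have hy: "h \<unrhd> y" if h: "h \<in> carrier G" "ord h = p" for h
    using uniq gen[OF h] gen[OF y] generate_singleton_iff[of h y] generate_singleton_iff[of y y] h y spans_refl
    by metis
  have span: "z \<unrhd> y" if z: "z \<in> carrier G" "z \<noteq> \<one>" "ord z \<noteq> 2" for z
  proof -
    have n4: "\<not> 4 dvd ord z" using no4 exists_spanned_of_ord[OF z(1)] by metis
    \<comment> \<open>As 4 does not divide \<open>ord z\<close>, this m is its odd part. It is not
      1, so it has an odd prime divisor, which can only be p.\<close>
    define m where "m = (if even (ord z) then ord z div 2 else ord z)"
    have "odd m" using n4 by (auto simp: m_def dvd_div_iff_mult)
    moreover have "m \<noteq> 1" using z ord_eq_1[OF z(1)] ord_pos[OF z(1)] by (auto simp: m_def elim!: evenE)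
    ultimately obtain q where q: "prime q" "q dvd m" "odd q"
      using prime_factor_nat by (metis dvd_trans)
    have "m dvd ord z" by (auto simp: m_def)
    then have qz: "q dvd ord z" using q by (metis dvd_trans)
    then have "q dvd order G" using ord_dvd_group_order[OF z(1)] by (metis dvd_trans)
    then have "q \<in> prime_factors (order G)"
      using q finite_carrier order_gt_0_iff_finite by (auto simp: prime_factors_dvd)
    then have "q = p" using pf q by auto
    then obtain h where "h \<in> carrier G" "z \<unrhd> h" "ord h = p" using exists_spanned_of_ord[OF z(1) qz] by blast
    then show ?thesis using hy spans_trans[OF z(1)] by blast
  qed
  have inv: "\<exists>z \<in> carrier G. ord z = 2 * p \<and> z \<unrhd> w" if w: "w \<in> carrier G" "ord w = 2" for w
  proof -
    obtain H where H: "subgroup H G" "cyclic_group (G\<lparr>carrier := H\<rparr>)" "card H = 2 * p" "w \<in> H"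
      using C4 w by blast
    interpret H: group "G\<lparr>carrier := H\<rparr>"
      using H(1) by (rule subgroup.subgroup_is_group) (rule is_group)
    obtain z where z: "z \<in> H" "H = range (\<lambda>n::int. z [^]\<^bsub>G\<lparr>carrier := H\<rparr>\<^esub> n)"
      using H(2) H.cyclic_group by auto
    have zG: "z \<in> carrier G" using z H subgroup.mem_carrier by metis
    have "H = range (\<lambda>n::int. z [^] n)"
      using z int_pow_consistent[OF H(1) z(1)] by simp
    then have "H = generate G {z}" using generate_pow[OF zG] by auto
    then show ?thesis
      using H zG generate_pow_card[OF zG] generate_singleton_iff[OF zG] by (intro bexI[of _ z]) auto
  qed
  obtain w0 where "w0 \<in> carrier G" "ord w0 = 2" using cauchy[OF two_is_prime_nat dvd(1)] .
  then show thesis using that[OF p y span inv] by blast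
qed

text \<open>The pair of y and the identity is critical and gives the lower bound. For the upper
  bound, a single arbitrary involution w0 resolves every critical pair.\<close>

lemma metric_dim_Psi:
  assumes "G \<in> Psi"
  shows "metric_dim (power_graph G) = order G - card (twin_classes G) + 1"
proof -
  obtain p y w0 where p: "prime p" "odd p" and y: "y \<in> carrier G" "ord y = p"
    and span: "\<And>z. z \<in> carrier G \<Longrightarrow> z \<noteq> \<one> \<Longrightarrow> ord z \<noteq> 2 \<Longrightarrow> z \<unrhd> y"
    and inv2p: "\<And>w. w \<in> carrier G \<Longrightarrow> ord w = 2 \<Longrightarrow> \<exists>z \<in> carrier G. ord z = 2 * p \<and> z \<unrhd> w"
    and w0: "w0 \<in> carrier G" "ord w0 = 2"
    by (rule PsiE[OF assms]) (rule that)
  have nadj: "\<not> w \<frown> u" if "w \<in> carrier G" "ord w = 2" "u \<in> carrier G" "ord u = p" for w u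
    using that spanned_by_involution[of w u] ord_dvd_if_spans[of u w] p by (auto simp: adj_def)
  have lone: "lone_involution w" if w: "w \<in> carrier G" "ord w = 2" for w
  proof -
    have "v = w" if wv: "w \<simeq> v" for v
    proof (rule ccontr)
      assume ne: "v \<noteq> w"
      have vG: "v \<in> carrier G" using twin_carrier[OF wv] by simp
      show False
      proof (cases "ord v = 2")
        case True
        \<comment> \<open>This z is adjacent to w, hence to its twin v, so the cyclic group of z
          would contain two involutions.\<close>
        obtain z where z: "z \<in> carrier G" "ord z = 2 * p" "z \<unrhd> w" using inv2p[OF w] by blast
        have zne: "z \<noteq> w" "z \<noteq> v" "z \<noteq> \<one>" using z w True p by (auto simp: prime_nat_iff)
        then have "w \<frown> z" using z w by (auto simp: adj_def)
        then have "v \<frown> z" using twin_adj_iff[OF wv] zne by blast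
        then have "z \<unrhd> v" using involution_adjD[OF vG True] zne by blast
        then show False using unique_spanned_involution[of z w v] z w True ne by auto
      next
        case False
        have iy: "inv y \<noteq> y" using inv_eq_self_iff[OF y(1)] y p by (auto simp: prime_nat_iff)
        \<comment> \<open>An element of order p other than v, chosen so that it is adjacent to v but
          not to w. As p is odd, \<open>inv y\<close> differs from y.\<close>
        define u where "u = (if v = y then inv y else y)"
        have u: "u \<in> carrier G" "ord u = p" "u \<noteq> v" "y \<unrhd> u"
          using y iy spans_inv[OF y(1)] spans_refl[OF y(1)] by (auto simp: u_def)
        have u1: "u \<noteq> \<one>" "u \<noteq> w" using u p w by auto
        have "v \<frown> u"
        proof (cases "v = \<one>")
          case True then show ?thesis using adj_one[OF u(1) u1(1)] adj_sym by blast
        next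
          case nv: False
          have "v \<unrhd> u" using spans_trans[OF vG span[OF vG nv False]] u by blast
          then show ?thesis using vG u by (auto simp: adj_def)
        qed
        then show False using twin_adj_iff[OF wv] nadj[OF w u(1,2)] u u1 by blast
      qed
    qed
    then show ?thesis using w twin_refl by (auto simp: lone_involution_def twin_class_iff)
  qed
  have c1: "critical y \<one>"
    unfolding critical_def
  proof (intro conjI ballI)
    have "w0 \<noteq> y" "w0 \<noteq> \<one>" using w0 y p by auto
    moreover from this have "\<one> \<frown> w0" using adj_one adj_sym w0 by blast
    ultimately show "\<not> y \<simeq> \<one>"
      using twin_adj_iff[of y \<one> w0] nadj[OF w0 y] adj_sym by blast
    fix z assume z: "z \<in> resolvers G y \<one> - {y, \<one>}"
    then have zG: "z \<in> carrier G" and "\<not> y \<frown> z"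
      using y adj_one[of z] adj_sym[of z \<one>] by (auto simp: resolvers_iff)
    then have "ord z = 2" using z span[of z] y by (auto simp: adj_def)
    then show "lone_involution z" using lone zG by blast
  qed (use y in auto)
  have hit: "w0 \<in> resolvers G x y'" if c: "critical x y'" for x y'
  proof -
    have *: "w0 \<in> resolvers G x u" if c: "critical x u" and xu: "x \<unrhd> u" for x u
    proof (cases "u = \<one>")
      case True
      then show ?thesis using critical_one_involution(2) c w0 by blast
    next
      case False
      obtain w where w: "resolvers G x u - {x, u} = {w}" "lone_involution w" "x \<unrhd> w"
        "prime (ord u)" "odd (ord u)"
        using critical_nontrivial[OF c xu False] .
      have G: "x \<in> carrier G" "u \<in> carrier G" using criticalD[OF c] by auto
      \<comment> \<open>This z generates y and hence u, which spans the same subgroup of order p.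
        Criticality makes z comparable with x, so the involutions w0 in \<langle>z\<rangle> and w in
        \<langle>x\<rangle> coincide.\<close>
      obtain z where z: "z \<in> carrier G" "ord z = 2 * p" "z \<unrhd> w0" using inv2p[OF w0] by blast
      have "u \<unrhd> y" using span[OF G(2) False] w(5) by fastforce
      moreover have "ord y = ord u"
        using ord_dvd_if_spans[OF G(2) \<open>u \<unrhd> y\<close>] y p w(4) by (simp add: primes_dvd_imp_eq)
      ultimately have "y \<unrhd> u" using spans_sym_if_ord_eq G by simp
      have zn: "z \<noteq> \<one>" "ord z \<noteq> 2" using z p by (auto simp: prime_nat_iff)
      have zu: "z \<unrhd> u" using spans_trans[OF z(1) span[OF z(1) zn]] \<open>y \<unrhd> u\<close> by blast
      have "z \<noteq> u" using z(2) w(5) by auto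
      then have "u \<frown> z" using zu G z by (auto simp: adj_def)
      then have "z = x \<or> x \<frown> z"
        using critical_cases[OF c z(1)] \<open>z \<noteq> u\<close> zn lone_involutionD(2) by blast
      then consider "x \<unrhd> z" | "z \<unrhd> x" using spans_refl G by (auto simp: adj_def)
      then have "w0 = w"
      proof cases
        case 1
        then show ?thesis
          using unique_spanned_involution[OF G(1) spans_trans[OF G(1) 1 z(3)] w(3) w0(2)] lone_involutionD w(2) by blast
      next
        case 2
        then show ?thesis
          using unique_spanned_involution[OF z(1) z(3) spans_trans[OF z(1) 2 w(3)] w0(2)] lone_involutionD w(2) by blast
      qed
      then show ?thesis using w by blast
    qed
    have "x \<unrhd> y' \<or> y' \<unrhd> x" using critical_imp_adj[OF c] by (auto simp: adj_def)
    then show ?thesis using *[OF c] *[OF critical_sym[OF c]] resolvers_commute by metis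
  qed
  obtain S where S: "resolves S" "card S = order G - card (twin_classes G) + card {w0}"
  proof (rule exists_resolving[of "{w0}"])
    show "lone_involution w" if "w \<in> {w0}" for w using lone w0 that by auto
    show "resolvers G x y \<inter> {w0} \<noteq> {}" if "critical x y" for x y using hit[OF that] by blast
  qed blast
  show ?thesis
  proof (rule metric_dim_eqI[OF S(1)])
    fix S assume S: "resolves S"
    obtain t where "t \<in> carrier G" "twin_class G t \<subseteq> S" using critical_blocks[OF S c1] by blast
    then show "order G - card (twin_classes G) + 1 \<le> card S"
      using card_resolving_ge[OF S, of "{twin_class G t}"] twin_class_in_classes by auto
  qed (use S in simp)
qed

section \<open>Groups outside \<open>Psi\<close>\<close>

text \<open>Several third resolvers could occur only when the identity is in the pair; but then G is
  cyclic and has a single involution.\<close>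

lemma critical_not_Psi:
  assumes nP: "G \<notin> Psi" and c: "critical x y"
  obtains w where "resolvers G x y - {x, y} = {w}"
proof -
  have *: "\<exists>w. resolvers G x y - {x, y} = {w}" if c: "critical x y" and xy: "x \<unrhd> y" for x y
  proof (cases "y = \<one>")
    case True
    then have cyc: "cyclic_group G" using critical_one_Psi c nP by blast
    obtain w where w: "w \<in> resolvers G x y - {x, y}" using critical_resolver_nonempty[OF c] by blast
    have "z = w" if "z \<in> resolvers G x y - {x, y}" for z
      using cyclic_unique_involution[OF cyc, of z w] criticalD(4)[OF c] lone_involutionD that w by blast
    then show ?thesis using w by blast
  next
    case False
    then show ?thesis using critical_nontrivial[OF c xy] by blast
  qed
  have "x \<unrhd> y \<or> y \<unrhd> x" using critical_imp_adj[OF c] by (auto simp: adj_def)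
  then show thesis
    using that *[OF c] *[OF critical_sym[OF c]] resolvers_commute[of x y] by (metis insert_commute)
qed

text \<open>In each triple x has even order, y has odd order and w is the involution of
  \<langle>x\<rangle>. Criticality passes to twins, so t and t' have the same role in their triples,
  and then x and x' generate the same involution.\<close>

lemma critical_triples_disjoint:
  assumes no1: "\<And>x. \<not> critical x \<one>"
    and c: "critical x y" "x \<unrhd> y" "resolvers G x y - {x, y} = {w}"
    and c': "critical x' y'" "x' \<unrhd> y'" "resolvers G x' y' - {x', y'} = {w'}"
    and t: "t \<in> {x, y, w}" "t' \<in> {x', y', w'}" "t \<simeq> t'"
  shows "w = w'"
proof -
  have A: "lone_involution w \<and> x \<unrhd> w \<and> odd (ord y) \<and> y \<noteq> \<one> \<and> even (ord x) \<and> x \<in> carrier G \<and> y \<in> carrier G \<and> ord w = 2"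
    if c: "critical x y" "x \<unrhd> y" "resolvers G x y - {x, y} = {w}" for x y w
  proof -
    have y1: "y \<noteq> \<one>" using no1 c by blast
    obtain v where "resolvers G x y - {x, y} = {v}" "lone_involution v" "x \<unrhd> v" "odd (ord y)"
      using critical_nontrivial[OF c(1,2) y1] .
    moreover from this have "v = w" using c by simp
    ultimately show ?thesis
      using y1 criticalD[OF c(1)] ord_dvd_if_spans[of x w] lone_involutionD(2)[of w] by auto
  qed
  note a = A[OF c] and a' = A[OF c']
  \<comment> \<open>A lone involution can only be the third member of a triple: y' has odd order,
    and x' generates y', which is neither the identity nor an involution.\<close>
  have mid: "t' = w'" if "w \<simeq> t'" "t' \<in> {x', y', w'}" "lone_involution w"
    "critical x' y'" "x' \<unrhd> y'" "resolvers G x' y' - {x', y'} = {w'}" for w t' x' y' w'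
  proof -
    note b = A[OF that(4-6)]
    have tw: "t' = w" "w \<in> carrier G" "ord w = 2" using that lone_involutionD by blast+
    have "\<not> w \<unrhd> y'" using spanned_by_involution[OF tw(2,3), of y'] b tw by auto
    then show ?thesis using that(2,5) tw b by auto
  qed
  have down: "x \<unrhd> y" if "critical x y" "even (ord x)" "odd (ord y)" for x y
    using critical_imp_adj[OF that(1)] that ord_dvd_if_spans[of y x] by (auto simp: adj_def dest: dvd_trans)
  \<comment> \<open>Replacing y' by its twin x would give a critical pair whose members both have
    even order, but the generated member must have odd order.\<close>
  have xy: False if c: "critical x y" and c': "critical x' y'" and "even (ord x)" "even (ord x')" "x \<simeq> y'" for x y x' y'
  proof -
    have "critical x' x" using critical_sym critical_twin c' twin_sym that(5) by blast
    moreover have "x' \<unrhd> x \<or> x \<unrhd> x'" using critical_imp_adj[OF calculation] by (auto simp: adj_def)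
    moreover have "x \<noteq> \<one>" "x' \<noteq> \<one>" using that by auto
    ultimately show False
      using critical_nontrivial[of x' x] critical_nontrivial[of x x'] critical_sym[of x' x] that by metis
  qed
  consider "t = w" | "t' = w'" | "t = x" "t' = x'" | "t = y" "t' = y'" | "t = x" "t' = y'" | "t = y" "t' = x'"
    using t by blast
  then show ?thesis
  proof cases
    case 1
    then have "t' = w'" using mid[OF _ t(2) _ c'] t a by blast
    then show ?thesis using 1 t a lone_involutionD(4) by blast
  next
    case 2
    then have "t = w" using mid[OF _ t(1) _ c] twin_sym[OF t(3)] a' by blast
    then show ?thesis using 2 t a lone_involutionD(4) by blast
  next
    case 3
    then have tw: "x' \<simeq> x" using t twin_sym by blast
    have cc: "critical x y'" using critical_twin[OF c'(1) tw] .
    have "resolvers G x y' - {x, y'} = {w'}" using resolvers_diff_twin[OF c'(1) tw] c' by simp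
    then have "x \<unrhd> w'" using A[OF cc down[OF cc]] a a' by blast
    then show ?thesis using unique_spanned_involution[of x w w'] a a' by blast
  next
    case 4
    then have tw: "y' \<simeq> y" using t twin_sym by blast
    have cc: "critical x' y" using critical_sym critical_twin c'(1) tw by blast
    have x'y: "x' \<unrhd> y" using down[OF cc] a a' by blast
    \<comment> \<open>As x' generates y and differs from w, it cannot separate x from y, so x and x'
      are comparable and share their unique involution.\<close>
    have "x' = x \<or> x \<frown> x'"
    proof -
      have "x' \<noteq> y" using a a' by auto
      moreover have "y \<frown> x'" using x'y \<open>x' \<noteq> y\<close> a a' by (auto simp: adj_def)
      moreover have "x' \<notin> resolvers G x y - {x, y}"
      proof
        assume "x' \<in> resolvers G x y - {x, y}"
        then have "x' = w" using c by blast
        then show False using spanned_by_involution[of w y] x'y a lone_involutionD(1)[of w] by auto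
      qed
      ultimately show ?thesis using critical_cases[OF c(1), of x'] a' by blast
    qed
    then consider "x \<unrhd> x'" | "x' \<unrhd> x" using spans_refl a by (auto simp: adj_def)
    then show ?thesis
    proof cases
      case 1 then show ?thesis using unique_spanned_involution[of x w w'] spans_trans[of x x' w'] a a' by blast
    next
      case 2 then show ?thesis using unique_spanned_involution[of x' w w'] spans_trans[of x' x w] a a' by blast
    qed
  next
    case 5 then show ?thesis using xy[OF c(1) c'(1)] a a' t by blast
  next
    case 6 then show ?thesis using xy[OF c'(1) c(1)] a a' t twin_sym by blast
  qed
qed

text \<open>Every critical pair has exactly one third resolver, a resolving involution, so c =
  \<open>?W\<close> works for the upper bound. For the lower bound, each w in \<open>?W\<close>
  forces a class into S, and these classes are distinct.\<close>

lemma metric_dim_not_Psi: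
  assumes nP: "G \<notin> Psi"
  shows "metric_dim (power_graph G) =
    order G - card (twin_classes G) + card (resolving_involutions G)"
proof -
  let ?W = "resolving_involutions G"
  have lone: "lone_involution w" if "w \<in> ?W" for w
    using that criticalD(4) unfolding mem_resolving_involutions_iff by blast
  obtain S where S: "resolves S" "card S = order G - card (twin_classes G) + card ?W"
  proof (rule exists_resolving[of ?W])
    show "resolvers G x y \<inter> ?W \<noteq> {}" if c: "critical x y" for x y
    proof -
      obtain w where w: "resolvers G x y - {x, y} = {w}" using critical_not_Psi[OF nP c] .
      then have "w \<in> ?W" using c unfolding mem_resolving_involutions_iff by blast
      then show ?thesis using w by blast
    qed
  qed (use lone in blast)+
  show ?thesis
  proof (rule metric_dim_eqI[OF S])
    fix S assume S: "resolves S"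
    have "\<exists>x y t. critical x y \<and> x \<unrhd> y \<and> resolvers G x y - {x, y} = {w} \<and> t \<in> {x, y, w} \<and>
        t \<in> carrier G \<and> twin_class G t \<subseteq> S" if "w \<in> ?W" for w
    proof -
      obtain x y where c: "critical x y" and R: "resolvers G x y - {x, y} = {w}"
        using \<open>w \<in> ?W\<close> unfolding mem_resolving_involutions_iff by blast
      obtain t where t: "t \<in> insert x (insert y (resolvers G x y))" "t \<in> carrier G" "twin_class G t \<subseteq> S"
        using critical_blocks[OF S c] .
      have txy: "t \<in> {x, y, w}" using t R by blast
      \<comment> \<open>The pair is ordered so that its first member generates the second, the form
        in which triples are compared.\<close>
      have "x \<unrhd> y \<or> y \<unrhd> x" using critical_imp_adj[OF c] by (auto simp: adj_def)
      then show ?thesis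
      proof
        assume "x \<unrhd> y" then show ?thesis using c R t txy by blast
      next
        assume "y \<unrhd> x"
        moreover have "resolvers G y x - {y, x} = {w}" using R by (simp add: resolvers_commute insert_commute)
        moreover have "t \<in> {y, x, w}" using txy by blast
        ultimately show ?thesis using critical_sym[OF c] t by blast
      qed
    qed
    then obtain X Y T where XYT: "\<And>w. w \<in> ?W \<Longrightarrow> critical (X w) (Y w) \<and> X w \<unrhd> Y w \<and>
        resolvers G (X w) (Y w) - {X w, Y w} = {w} \<and> T w \<in> {X w, Y w, w} \<and>
        T w \<in> carrier G \<and> twin_class G (T w) \<subseteq> S"
      by metis
    have inj: "inj_on (\<lambda>w. twin_class G (T w)) ?W"
    proof (rule inj_onI)
      fix w w' assume w: "w \<in> ?W" "w' \<in> ?W" and eq: "twin_class G (T w) = twin_class G (T w')"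
      show "w = w'"
      \<comment> \<open>Triples containing the identity need not be compared: a critical pair with
        the identity makes G cyclic, with at most one involution.\<close>
      proof (cases "\<exists>x. critical x \<one>")
        case True
        then have "cyclic_group G" using critical_one_Psi nP by blast
        then show ?thesis
          using cyclic_unique_involution lone lone_involutionD(1,2) w by blast
      next
        case False
        note A = XYT[OF w(1)] and B = XYT[OF w(2)]
        have "T w \<simeq> T w'" using twin_class_eq_iff[of "T w" "T w'"] eq A B by blast
        then show ?thesis
          using critical_triples_disjoint[of "X w" "Y w" w "X w'" "Y w'" w' "T w" "T w'"] A B False
          by blast
      qed
    qed
    have "order G - card (twin_classes G) + card ((\<lambda>w. twin_class G (T w)) ` ?W) \<le> card S"
    proof (rule card_resolving_ge[OF S])
      show "(\<lambda>w. twin_class G (T w)) ` ?W \<subseteq> twin_classes G"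
        using XYT twin_class_in_classes by (meson image_subsetI)
      show "C \<subseteq> S" if C: "C \<in> (\<lambda>w. twin_class G (T w)) ` ?W" for C
      proof -
        obtain w where "w \<in> ?W" "C = twin_class G (T w)" using C by (rule imageE)
        then show ?thesis using XYT[of w] by simp
      qed
    qed
    then show "order G - card (twin_classes G) + card ?W \<le> card S"
      by (simp add: card_image[OF inj])
  qed
qed

end

theorem theorem3p26:
  fixes G :: "('a, 'b) monoid_scheme"
  assumes "group G" and "finite (carrier G)"
  shows "(G \<in> Psi \<longrightarrow>
            metric_dim (power_graph G) = order G - card (twin_classes G) + 1) \<and>
         (G \<notin> Psi \<longrightarrow>
            metric_dim (power_graph G) =
              order G - card (twin_classes G) + card (resolving_involutions G))"
proof -
  interpret finite_group G
    using assms by (simp add: finite_group_def finite_group_axioms_def)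
  show ?thesis using metric_dim_Psi metric_dim_not_Psi by blast
qed

end
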